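(* The $L^2$-orthogonal complement $T_{\mathrm{id}}\mathrm{Aut}(H)^\perp$ in $\mathrm{VF}(S^3)$ of the tangent space at the identity of the automorphism group $\mathrm{Aut}(H)$ coincides with the subspace $\mathrm{BVF}(S^3)$ of horizontal vector fields on $S^3$ which are balanced with respect to the Hopf fibration $H$. In other words, $$\mathrm{PVF}(S^3)\oplus\mathrm{BVF}(S^3)=\mathrm{VF}(S^3),$$ where $\mathrm{PVF}(S^3)=T_{\mathrm{id}}\mathrm{Aut}(H)$.
   Context: View $S^3$ as the unit quaternions with its round metric and let $H$ be the Hopf fibration $p:S^3\to S^2$ with fibers the great circles $\{xe^{it}:0\le t\le 2\pi\}$. $\mathrm{VF}(S^3)$ is the space of smooth vector fields on $S^3$, with $L^2$ inner product $\langle X,Y\rangle=\int_{S^3}X(x)\cdot Y(x)\,d\mathrm{Vol}$. $\mathrm{Aut}(H)$ is the group of diffeomorphisms of $S^3$ which permute the fibers of $H$; $T_{\mathrm{id}}\mathrm{Aut}(H)$ is its tangent space at the identity (the velocities at $t=0$ of smooth curves in $\mathrm{Aut}(H)$ through the identity). It equals the space $\mathrm{PVF}(S^3)$ of projectable vector fields: smooth vector fields on $S^3$ which project under $p_*$ to a well-defined vector field on $S^2$. A vector field is horizontal if it is everywhere orthogonal to the Hopf fibers. A smooth vector field $V$ on $S^3$ is balanced if it is horizontal and for each Hopf fiber $F$, the integral $\int_F p_*V\,dt$ with respect to arc length along $F$, which is a vector in $T_{p(F)}S^2$, is zero. *)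

theory Defs
  imports
    "HOL-Analysis.Analysis"
    "HOL-Library.Function_Algebras"
    "HOL-Library.Set_Algebras"
begin

section \<open>Smooth maps\<close>

text \<open>For open \<open>U\<close>, \<open>Ck_on k U f\<close> says that \<open>f\<close> is \<open>k\<close> times continuously differentiable on \<open>U\<close>:
  all iterated directional derivatives up to order \<open>k\<close> exist and are continuous.\<close>

primrec Ck_on ::
    "nat \<Rightarrow> 'a::real_normed_vector set \<Rightarrow> ('a \<Rightarrow> 'b::real_normed_vector) \<Rightarrow> bool" where
  "Ck_on 0 U f \<longleftrightarrow> continuous_on U f"
| "Ck_on (Suc k) U f \<longleftrightarrow>
     (\<forall>x\<in>U. f differentiable (at x)) \<and> (\<forall>v. Ck_on k U (\<lambda>x. frechet_derivative f (at x) v))"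

text \<open>A map on an arbitrary subset \<open>M\<close> of a normed space (here always an embedded submanifold)
  is smooth if near each point of \<open>M\<close> it is the restriction of a smooth map on an open set of the
  ambient space.\<close>

definition smooth_on ::
    "'a::real_normed_vector set \<Rightarrow> ('a \<Rightarrow> 'b::real_normed_vector) \<Rightarrow> bool" where
  "smooth_on M f \<longleftrightarrow>
     (\<forall>x\<in>M. \<exists>U g. open U \<and> x \<in> U \<and> (\<forall>k. Ck_on k U g) \<and> (\<forall>y\<in>U \<inter> M. g y = f y))"


section \<open>Quaternions, the three-sphere and the Hopf fibration\<close>

text \<open>The pair \<open>(z, w)\<close> stands for the quaternion \<open>z + j w\<close>, where \<open>z j = j (cnj z)\<close>.
  The inner product of \<^typ>\<open>complex \<times> complex\<close> is the Euclidean one of \<open>\<real>\<^sup>4\<close>.\<close>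

type_synonym quat = "complex \<times> complex"

definition qmult :: "quat \<Rightarrow> quat \<Rightarrow> quat" where
  "qmult x y = (fst x * fst y - cnj (snd x) * snd y, cnj (fst x) * snd y + snd x * fst y)"

definition qcnj :: "quat \<Rightarrow> quat" where
  "qcnj x = (cnj (fst x), - snd x)"

definition S3 :: "quat set" where
  "S3 = sphere 0 1"

text \<open>The unit sphere in the space of purely imaginary quaternions.\<close>

definition S2 :: "quat set" where
  "S2 = {y. norm y = 1 \<and> Re (fst y) = 0}"

definition hopf_circle :: "quat \<Rightarrow> real \<Rightarrow> quat" where
  "hopf_circle x t = qmult x (cis t, 0)"

definition hopf_fiber :: "quat \<Rightarrow> quat set" where
  "hopf_fiber x = hopf_circle x ` {0..2*pi}"

definition hopf_fibers :: "quat set set" where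
  "hopf_fibers = hopf_fiber ` S3"

text \<open>The projection \<open>x \<mapsto> x i x\<inverse>\<close> of the fibration.  This formula extends it to a polynomial map
  of all quaternions, whose Frechet derivative at \<open>x \<in> S3\<close> agrees with the differential of the
  projection on vectors tangent to the sphere.\<close>

definition hopf :: "quat \<Rightarrow> quat" where
  "hopf x = qmult (qmult x (\<i>, 0)) (qcnj x)"

definition hopf_push :: "quat \<Rightarrow> quat \<Rightarrow> quat" where
  "hopf_push x v = frechet_derivative hopf (at x) v"

lemma norm_qmult: "norm (qmult x y) = norm x * norm y"
proof -
  obtain a b c d where x: "x = (Complex a b, Complex c d)"
    by (metis complex.exhaust surj_pair)
  obtain a' b' c' d' where y: "y = (Complex a' b', Complex c' d')"
    by (metis complex.exhaust surj_pair)
  have "(norm (qmult x y))\<^sup>2 = (norm x * norm y)\<^sup>2"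
    unfolding x y power_mult_distrib qmult_def norm_prod_def
    by (simp add: cmod_power2) algebra
  then show ?thesis
    by (simp add: power2_eq_iff_nonneg)
qed

lemma hopf_in_S2:
  assumes "x \<in> S3"
  shows "hopf x \<in> S2"
proof -
  have "norm (qcnj x) = norm x" "norm (\<i>, 0::complex) = 1"
    by (simp_all add: qcnj_def norm_prod_def)
  moreover have "Re (fst (hopf x)) = 0"
    by (simp add: hopf_def qmult_def qcnj_def algebra_simps)
  ultimately show ?thesis
    using assms by (simp add: S3_def S2_def hopf_def norm_qmult)
qed

lemma hopf_fiber_eq:
  assumes "x \<in> S3"
  shows "hopf_fiber x = {y \<in> S3. hopf y = hopf x}"
proof (intro equalityI subsetI)
  fix y assume "y \<in> hopf_fiber x"
  then obtain t where y: "y = qmult x (cis t, 0)"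
    by (auto simp: hopf_fiber_def hopf_circle_def)
  have "cis t * cnj (cis t) = 1"
    by (simp add: cis_cnj cis_mult)
  then have "hopf y = hopf x"
    unfolding y hopf_def qmult_def qcnj_def by simp algebra
  moreover have "y \<in> S3"
    using assms norm_qmult[of x "(cis t, 0)"] by (simp add: y S3_def norm_Pair)
  ultimately show "y \<in> {y \<in> S3. hopf y = hopf x}" by simp
next
  fix y assume y: "y \<in> {y \<in> S3. hopf y = hopf x}"
  obtain z w where x: "x = (z, w)" by (cases x)
  obtain z' w' where y': "y = (z', w')" by (cases y)
  have norm1: "a * cnj a + b * cnj b = 1" if "(a, b) \<in> S3" for a b
  proof -
    have "(cmod a)\<^sup>2 + (cmod b)\<^sup>2 = 1"
      using that by (simp add: S3_def norm_prod_def)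
    then show ?thesis
      by (metis complex_norm_square of_real_1 of_real_add)
  qed
  have n: "z * cnj z + w * cnj w = 1" and n': "z' * cnj z' + w' * cnj w' = 1"
    using assms y norm1 unfolding x y' by blast+
  have eq: "hopf (z', w') = hopf (z, w)"
    using y y' x by simp
  have "\<i> * (z' * cnj z' - w' * cnj w') = \<i> * (z * cnj z - w * cnj w)"
    using eq by (simp add: hopf_def qmult_def qcnj_def algebra_simps)
  then have d: "z' * cnj z' - w' * cnj w' = z * cnj z - w * cnj w"
    by simp
  have "2 * \<i> * (cnj z' * w') = 2 * \<i> * (cnj z * w)"
    using eq by (simp add: hopf_def qmult_def qcnj_def algebra_simps)
  then have m: "cnj z' * w' = cnj z * w"
    by simp
  then have m': "z' * cnj w' = z * cnj w"
    by (metis complex_cnj_cnj complex_cnj_mult)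
  have zz: "z' * cnj z' = z * cnj z"
    using n n' d by algebra
  have ww: "w' * cnj w' = w * cnj w"
    using n n' d by algebra
  define c where "c = cnj z * z' + cnj w * w'"
  have "z * c = z'"
    unfolding c_def using n ww m' by algebra
  moreover have "w * c = w'"
    unfolding c_def using n zz m by algebra
  ultimately have yc: "y = qmult x (c, 0)"
    by (simp add: x y' qmult_def)
  have "norm y = norm x * norm (c, 0::complex)"
    by (simp only: yc norm_qmult)
  then have "cmod c = 1"
    using assms y by (simp add: S3_def norm_prod_def)
  then obtain t where "0 \<le> t" "t < 2 * pi" "c = cis t"
    by (metis Arg2pi Arg2pi_eq cis_conv_exp mult.commute mult_1 of_real_1)
  then show "y \<in> hopf_fiber x"
    by (auto simp: hopf_fiber_def hopf_circle_def yc)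
qed


section \<open>Vector fields on the spheres\<close>

text \<open>Fields are functions on the ambient space that vanish off the sphere, so that equality of
  functions is equality of fields.\<close>

definition VF_S3 :: "(quat \<Rightarrow> quat) set" where
  "VF_S3 = {V. smooth_on S3 V \<and> (\<forall>x\<in>S3. V x \<bullet> x = 0) \<and> (\<forall>x. x \<notin> S3 \<longrightarrow> V x = 0)}"

definition VF_S2 :: "(quat \<Rightarrow> quat) set" where
  "VF_S2 = {Y. smooth_on S2 Y \<and> (\<forall>y\<in>S2. Re (fst (Y y)) = 0 \<and> Y y \<bullet> y = 0)
             \<and> (\<forall>y. y \<notin> S2 \<longrightarrow> Y y = 0)}"

text \<open>Surface measure of the unit sphere in an \<open>n\<close>-dimensional Euclidean space, as in integration
  in polar coordinates: the measure of \<open>A\<close> is \<open>n\<close> times the Lebesgue measure of the cone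
  \<open>{r *\<^sub>R a | r a. 0 < r \<and> r \<le> 1 \<and> a \<in> A}\<close>.  Note that \<^term>\<open>sgn x\<close> is \<open>x\<close> divided by its norm.\<close>

definition sphere_measure :: "'a::euclidean_space measure" where
  "sphere_measure = scale_measure (of_nat DIM('a))
     (distr (restrict_space lborel (cball 0 1 - {0})) (restrict_space borel (sphere 0 1)) sgn)"

definition L2_inner :: "(quat \<Rightarrow> quat) \<Rightarrow> (quat \<Rightarrow> quat) \<Rightarrow> real" where
  "L2_inner X Y = (\<integral>x. X x \<bullet> Y x \<partial>sphere_measure)"

definition L2_orthogonal_complement :: "(quat \<Rightarrow> quat) set \<Rightarrow> (quat \<Rightarrow> quat) set" where
  "L2_orthogonal_complement U = {V \<in> VF_S3. \<forall>X\<in>U. L2_inner V X = 0}"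

lemma sphere_measure_S3: "emeasure (sphere_measure :: quat measure) S3 = ennreal (2 * pi\<^sup>2)"
proof -
  let ?M = "restrict_space lborel (cball 0 1 - {0}) :: quat measure"
  let ?N = "restrict_space borel (sphere 0 1) :: quat measure"
  have meas: "sgn \<in> measurable ?M ?N"
  proof (rule measurable_restrict_space2)
    show "sgn \<in> space ?M \<rightarrow> sphere 0 1"
      by (auto simp: space_restrict_space norm_sgn)
    have "sgn \<in> borel_measurable (borel :: quat measure)"
      unfolding sgn_div_norm by measurable
    then show "sgn \<in> borel_measurable ?M"
      by (simp add: measurable_restrict_space1)
  qed
  have "emeasure (distr ?M ?N sgn) S3 = emeasure ?M (space ?M)"
  proof (subst emeasure_distr[OF meas])
    show "S3 \<in> sets ?N"
      by (auto simp: S3_def sets_restrict_space)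
    show "emeasure ?M (sgn -` S3 \<inter> space ?M) = emeasure ?M (space ?M)"
      by (rule arg_cong[where f = "emeasure ?M"]) (auto simp: S3_def space_restrict_space norm_sgn)
  qed
  also have "\<dots> = emeasure lborel (cball (0::quat) 1 - {0})"
    by (simp add: emeasure_restrict_space space_restrict_space)
  also have "\<dots> = emeasure lborel (cball (0::quat) 1)"
    by (subst emeasure_Diff) auto
  also have "\<dots> = ennreal (pi\<^sup>2 / 2)"
    by (simp add: emeasure_cball unit_ball_vol_4)
  finally show ?thesis
    by (simp add: sphere_measure_def flip: ennreal_numeral ennreal_mult)
qed


section \<open>Automorphisms of the Hopf fibration\<close>

definition Diff_S3 :: "(quat \<Rightarrow> quat) set" where
  "Diff_S3 = {f \<in> extensional S3. bij_betw f S3 S3 \<and> smooth_on S3 f \<and> smooth_on S3 (inv_into S3 f)}"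

definition Aut_H :: "(quat \<Rightarrow> quat) set" where
  "Aut_H = {f \<in> Diff_S3. bij_betw (\<lambda>F. f ` F) hopf_fibers hopf_fibers}"

text \<open>Velocities at time 0 of smooth curves \<open>\<phi>\<close> in \<^const>\<open>Aut_H\<close> through the identity; a curve of
  diffeomorphisms is smooth if it is jointly smooth in time and space.\<close>

definition T_id_Aut_H :: "(quat \<Rightarrow> quat) set" where
  "T_id_Aut_H = {X. (\<forall>x. x \<notin> S3 \<longrightarrow> X x = 0) \<and>
     (\<exists>\<epsilon>>0. \<exists>\<phi> :: real \<Rightarrow> quat \<Rightarrow> quat.
        (\<forall>t\<in>{-\<epsilon><..<\<epsilon>}. \<phi> t \<in> Aut_H) \<and>
        smooth_on ({-\<epsilon><..<\<epsilon>} \<times> S3) (\<lambda>(t, x). \<phi> t x) \<and>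
        (\<forall>x\<in>S3. \<phi> 0 x = x) \<and>
        (\<forall>x\<in>S3. ((\<lambda>t. \<phi> t x) has_vector_derivative X x) (at 0)))}"


section \<open>Projectable and balanced fields\<close>

definition PVF :: "(quat \<Rightarrow> quat) set" where
  "PVF = {V \<in> VF_S3. \<exists>Y\<in>VF_S2. \<forall>x\<in>S3. hopf_push x (V x) = Y (hopf x)}"

definition horizontal :: "(quat \<Rightarrow> quat) \<Rightarrow> bool" where
  "horizontal V \<longleftrightarrow> (\<forall>x\<in>S3. V x \<bullet> vector_derivative (hopf_circle x) (at 0) = 0)"

text \<open>The parametrization \<^term>\<open>hopf_circle x\<close> of the fiber through \<open>x\<close> has unit speed, and the
  integrand takes values in the fixed tangent space of the 2-sphere at \<^term>\<open>hopf x\<close>.\<close>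

definition balanced :: "(quat \<Rightarrow> quat) \<Rightarrow> bool" where
  "balanced V \<longleftrightarrow> horizontal V \<and>
     (\<forall>x\<in>S3. ((\<lambda>t. hopf_push (hopf_circle x t) (V (hopf_circle x t))) has_integral 0) {0..2*pi})"

definition BVF :: "(quat \<Rightarrow> quat) set" where
  "BVF = {V \<in> VF_S3. balanced V}"


section \<open>Direct sums of spaces of fields\<close>

abbreviation linear_subspace :: "('a \<Rightarrow> 'b::real_vector) set \<Rightarrow> bool" where
  "linear_subspace \<equiv> module.subspace (\<lambda>(c::real) V x. c *\<^sub>R V x)"

definition is_direct_sum ::
    "('a \<Rightarrow> 'b::real_vector) set \<Rightarrow> ('a \<Rightarrow> 'b) set \<Rightarrow> ('a \<Rightarrow> 'b) set \<Rightarrow> bool" where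
  "is_direct_sum U W V \<longleftrightarrow>
     linear_subspace U \<and> linear_subspace W \<and> U \<inter> W = {0} \<and> U + W = V"

end

(*
  Left translation trivialises the tangent bundle of the sphere: a tangent field is
  V(x) = x (i f(x) + j h(x)) with f real and h complex.  Along a Hopf circle the push-forward
  of V is e^{-2it} h(x e^{it}) in a fixed frame, so V is projectable iff h(x e^{it}) = e^{2it} h(x),
  and balanced iff f = 0 and e^{-2it} h(x e^{it}) has mean zero on every circle.  Averaging
  e^{-2it} h(x e^{it}) over the circle therefore splits every field into a projectable and a
  balanced part, and the two parts are orthogonal because the surface measure is invariant under
  the circle action.

  Velocities of curves in Aut(H) are projectable since such curves respect fibres.  Conversely a
  projectable V is the velocity of x -> (x + t x j h(x)) (1 + i t f(x)), normalised.  For small t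
  this is, after homogeneous extension, a Lipschitz-small perturbation of the identity of R^4, so
  Banach's fixed point theorem gives bijectivity and the derivative formula for inverses gives
  smoothness of the inverse.
*)

theory Submission
  imports Defs
begin


section \<open>Calculus of smooth maps\<close>

text \<open>Contraction arguments and the derivative formula for inverses are used on open sets of
  R^4 rather than on the sphere; this is why the curve is extended homogeneously. The extension
  preserves norms, so its global inverse restricts to an inverse on \<open>S3\<close>. The price is
  the origin, where the extension need not be differentiable: the Lipschitz estimate must be carried
  across it by a separate argument, and smoothness of the inverse is obtained only on the image of
  its complement.

  Projectability asks for a smooth field on the 2-sphere, while the frame computation only gives
  invariance along fibres; two explicit local sections, each missing one pole, bridge the gap.

  Averaging has to stay within smooth fields. Since it does, the orthogonal complement requires no
  L2 closure: a field orthogonal to \<open>PVF\<close> is paired with its own projectable part,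
  whose norm must then vanish.

  The surface measure is defined by Lebesgue volumes of cones, so its invariance is reduced to that
  of Lebesgue measure under orthogonal maps.\<close>

lemma Ck_on_differentiable:
  "Ck_on (Suc k) U f \<Longrightarrow> x \<in> U \<Longrightarrow> (f has_derivative frechet_derivative f (at x)) (at x)"
  using frechet_derivative_works by auto

lemma Ck_on_subset: "Ck_on k U f \<Longrightarrow> V \<subseteq> U \<Longrightarrow> Ck_on k V f"
  by (induction k arbitrary: f) (auto intro: continuous_on_subset)

lemma Ck_on_cong:
  assumes "open U" "\<And>x. x \<in> U \<Longrightarrow> f x = g x" "Ck_on k U f"
  shows "Ck_on k U g"
  using assms(2,3)
proof (induction k arbitrary: f g)
  case 0
  then show ?case using continuous_on_cong by force
next
  case (Suc k)
  have der: "(g has_derivative frechet_derivative f (at x)) (at x)" if "x \<in> U" for x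
    using has_derivative_transform_within_open[OF Ck_on_differentiable[OF Suc.prems(2) that] assms(1) that]
      Suc.prems(1) by blast
  then have eq: "frechet_derivative f (at x) = frechet_derivative g (at x)" if "x \<in> U" for x
    using that frechet_derivative_at by blast
  have "Ck_on k U (\<lambda>x. frechet_derivative g (at x) v)" for v
    by (rule Suc.IH[of "\<lambda>x. frechet_derivative f (at x) v"]) (use eq Suc.prems in auto)
  then show ?case using der by (auto simp: differentiable_def)
qed

text \<open>Derivatives are unique, so any explicit formula \<open>f'\<close> may stand in for
  \<open>frechet_derivative\<close>. Openness of \<open>U\<close> matters: the two agree only on
  \<open>U\<close>, and further derivatives must not see other points.\<close>

lemma Ck_on_SucI:
  assumes "open U" "\<And>x. x \<in> U \<Longrightarrow> (f has_derivative f' x) (at x)"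
    "\<And>v. Ck_on k U (\<lambda>x. f' x v)"
  shows "Ck_on (Suc k) U f"
proof -
  have "\<forall>x\<in>U. f' x = frechet_derivative f (at x)"
    using assms(2) frechet_derivative_at by blast
  then have "Ck_on k U (\<lambda>x. frechet_derivative f (at x) v)" for v
    using Ck_on_cong[OF assms(1) _ assms(3)[of v]] by auto
  then show ?thesis using assms(2) by (auto simp: differentiable_def)
qed

lemma Ck_on_local:
  assumes "\<And>x. x \<in> U \<Longrightarrow> \<exists>N. open N \<and> x \<in> N \<and> Ck_on k N f"
  shows "Ck_on k U f"
  using assms
proof (induction k arbitrary: f)
  case 0
  then have "continuous_on U f"
    by (metis Ck_on.simps(1) continuous_at_imp_continuous_on continuous_on_eq_continuous_at)
  then show ?case by simp
next
  case (Suc k)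
  show ?case
  proof (simp, intro conjI allI ballI)
    show "f differentiable at x" if "x \<in> U" for x
      using Suc.prems[OF that] by auto
    show "Ck_on k U (\<lambda>x. frechet_derivative f (at x) v)" for v
      by (rule Suc.IH) (use Suc.prems in force)
  qed
qed

lemma Ck_on_Suc_imp:
  assumes "Ck_on (Suc k) U f"
  shows "Ck_on k U f"
  using assms
proof (induction k arbitrary: f)
  case 0
  then show ?case
    by (auto intro: differentiable_imp_continuous_on differentiable_at_imp_differentiable_on)
next
  case (Suc k)
  then show ?case by (metis Ck_on.simps(2))
qed

lemma Ck_on_const: "Ck_on k U (\<lambda>x. c)"
  by (induction k arbitrary: c) (auto simp: frechet_derivative_const)

lemma Ck_on_bounded_linear:
  assumes "bounded_linear f" "open U"
  shows "Ck_on k U f"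
proof (cases k)
  case 0
  then show ?thesis using assms linear_continuous_on by auto
next
  case (Suc m)
  show ?thesis unfolding Suc
    by (rule Ck_on_SucI[where f' = "\<lambda>_. f"])
      (use assms in \<open>auto intro: bounded_linear_imp_has_derivative Ck_on_const\<close>)
qed

lemma Ck_on_add:
  assumes "open U" "Ck_on k U f" "Ck_on k U g"
  shows "Ck_on k U (\<lambda>x. f x + g x)"
  using assms(2,3)
proof (induction k arbitrary: f g)
  case 0
  then show ?case by (auto intro: continuous_on_add)
next
  case (Suc k)
  show ?case
    by (rule Ck_on_SucI[OF assms(1) has_derivative_add[OF
          Ck_on_differentiable[OF Suc.prems(1)] Ck_on_differentiable[OF Suc.prems(2)]]])
      (use Suc in auto)
qed

lemma Ck_on_sum:
  assumes "open U" "\<And>i. i \<in> I \<Longrightarrow> Ck_on k U (f i)"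
  shows "Ck_on k U (\<lambda>x. \<Sum>i\<in>I. f i x)"
  using assms(2)
  by (induction I rule: infinite_finite_induct) (auto intro: Ck_on_const Ck_on_add assms(1))

text \<open>The product rule turns one term into two of the same shape, with one factor
  differentiated in each; the induction closes because it ranges over both factors.\<close>

lemma Ck_on_bounded_bilinear:
  assumes "bounded_bilinear B" "open U" "Ck_on k U f" "Ck_on k U g"
  shows "Ck_on k U (\<lambda>x. B (f x) (g x))"
  using assms(3,4)
proof (induction k arbitrary: f g)
  case 0
  then show ?case by (auto intro: bounded_bilinear.continuous_on[OF assms(1)])
next
  case (Suc k)
  show ?case
    by (rule Ck_on_SucI[OF assms(2) bounded_bilinear.FDERIV[OF assms(1)
            Ck_on_differentiable[OF Suc.prems(1)] Ck_on_differentiable[OF Suc.prems(2)]]])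
      (auto intro!: Ck_on_add[OF assms(2)] Suc.IH Ck_on_Suc_imp[OF Suc.prems(1)]
         Ck_on_Suc_imp[OF Suc.prems(2)] simp del: Ck_on.simps(1) simp: Suc.prems[simplified])
qed

lemma Ck_on_linear_compose:
  assumes "bounded_linear h" "open U" "Ck_on k U f"
  shows "Ck_on k U (\<lambda>x. h (f x))"
  using assms(3)
proof (induction k arbitrary: f)
  case 0
  then show ?case by (auto intro: bounded_linear.continuous_on[OF assms(1)])
next
  case (Suc k)
  show ?case
    by (rule Ck_on_SucI[OF assms(2) bounded_linear.has_derivative[OF assms(1)
            Ck_on_differentiable[OF Suc.prems(1)]]])
      (auto intro!: Suc.IH simp: Suc.prems[simplified])
qed

lemma linear_basis_expansion:
  fixes w :: "'a::euclidean_space"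
  assumes "linear L"
  shows "L w = (\<Sum>b\<in>Basis. (w \<bullet> b) *\<^sub>R L b)"
  by (metis (no_types, lifting) assms euclidean_representation linear_cmul linear_sum sum.cong)

text \<open>\<open>Ck_on\<close> controls derivatives only in fixed directions, whereas the chain
  rule differentiates \<open>f\<close> in the moving direction Dg(x) v. Expanding that direction in
  a basis of the Euclidean codomain of \<open>g\<close> gives sums of products covered by the
  induction.\<close>

lemma Ck_on_compose:
  fixes g :: "'a::real_normed_vector \<Rightarrow> 'b::euclidean_space"
  assumes "open U" "open V" "g ` U \<subseteq> V" "Ck_on k U g" "Ck_on k V f"
  shows "Ck_on k U (\<lambda>x. f (g x))"
  using assms(4,5)
proof (induction k arbitrary: f)
  case 0
  then show ?case using assms(3) by (auto intro: continuous_on_compose2)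
next
  case (Suc k)
  have der: "((\<lambda>x. f (g x)) has_derivative
      (\<lambda>v. frechet_derivative f (at (g x)) (frechet_derivative g (at x) v))) (at x)" if "x \<in> U" for x
    using has_derivative_compose[OF Ck_on_differentiable[OF Suc.prems(1) that]
        Ck_on_differentiable[OF Suc.prems(2)]] assms(3) that by blast
  have Ck: "Ck_on k U (\<lambda>x. \<Sum>b\<in>Basis. (frechet_derivative g (at x) v \<bullet> b) *\<^sub>R
      frechet_derivative f (at (g x)) b)" for v
  proof (intro Ck_on_sum Ck_on_bounded_bilinear[OF bounded_bilinear_scaleR] assms(1))
    fix b :: 'b
    show "Ck_on k U (\<lambda>x. frechet_derivative g (at x) v \<bullet> b)"
      using Suc.prems by (auto intro: Ck_on_linear_compose[OF bounded_linear_inner_left assms(1)])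
    show "Ck_on k U (\<lambda>x. frechet_derivative f (at (g x)) b)"
      by (rule Suc.IH[OF Ck_on_Suc_imp[OF Suc.prems(1)]]) (use Suc.prems in auto)
  qed
  have "Ck_on k U (\<lambda>x. frechet_derivative f (at (g x)) (frechet_derivative g (at x) v))" for v
  proof (rule Ck_on_cong[OF assms(1) _ Ck[of v]])
    fix x assume "x \<in> U"
    then have "linear (frechet_derivative f (at (g x)))"
      using Suc.prems(2) assms(3) by (auto intro: linear_frechet_derivative)
    then show "(\<Sum>b\<in>Basis. (frechet_derivative g (at x) v \<bullet> b) *\<^sub>R frechet_derivative f (at (g x)) b)
        = frechet_derivative f (at (g x)) (frechet_derivative g (at x) v)"
      by (rule linear_basis_expansion[symmetric])
  qed
  then show ?case
    using der by (intro Ck_on_SucI[OF assms(1), where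
          f' = "\<lambda>x v. frechet_derivative f (at (g x)) (frechet_derivative g (at x) v)"])
qed

text \<open>Bootstrapping: the derivative of \<open>inverse\<close> is built from copies of
  \<open>inverse\<close>, so order k gives order k + 1. \<open>sqrt\<close> and \<open>cis\<close>
  below are treated the same way, the former through \<open>inverse\<close>.\<close>

lemma Ck_on_inverse: "Ck_on k (- {0}) (inverse :: real \<Rightarrow> real)"
proof (induction k)
  case 0
  then show ?case by (auto intro!: continuous_intros)
next
  case (Suc k)
  have open0: "open (- {0::real})" by (simp add: open_Compl)
  show ?case
  proof (rule Ck_on_SucI)
    show "(inverse has_derivative (\<lambda>h. - (inverse x * h * inverse x))) (at x)"
      if "x \<in> - {0}" for x :: real
      using that by (auto intro: has_derivative_inverse')
    show "Ck_on k (- {0}) (\<lambda>x. - (inverse x * v * inverse x))" for v :: real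
      by (intro Ck_on_linear_compose[OF bounded_linear_minus[OF bounded_linear_ident]]
          Ck_on_bounded_bilinear[OF bounded_bilinear_mult] Suc Ck_on_const open0)
  qed (rule open0)
qed

lemma Ck_on_sqrt: "Ck_on k {0<..} sqrt"
proof (induction k)
  case 0
  then show ?case by (auto intro!: continuous_intros)
next
  case (Suc k)
  show ?case
  proof (rule Ck_on_SucI)
    show "(sqrt has_derivative (\<lambda>h. inverse (sqrt x) / 2 * h)) (at x)"
      if "x \<in> {0<..}" for x :: real
      using DERIV_real_sqrt[of x] that
      unfolding has_field_derivative_def greaterThan_iff by blast
    have "Ck_on k {0<..} (\<lambda>x. inverse (sqrt x))"
      by (rule Ck_on_compose[OF _ _ _ Suc Ck_on_inverse]) auto
    then show "Ck_on k {0<..} (\<lambda>x. inverse (sqrt x) / 2 * v)" for v :: real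
      using Ck_on_linear_compose[OF bounded_linear_mult_left[of "v/2"] open_greaterThan] by fastforce
  qed simp
qed

lemma Ck_on_cis: "Ck_on k UNIV cis"
proof (induction k)
  case 0
  then show ?case by (auto intro!: continuous_intros)
next
  case (Suc k)
  show ?case
  proof (rule Ck_on_SucI)
    show "(cis has_derivative (\<lambda>h. h *\<^sub>R (\<i> * cis x))) (at x)" for x
      by (auto intro!: derivative_eq_intros)
    show "Ck_on k UNIV (\<lambda>x. v *\<^sub>R (\<i> * cis x))" for v :: real
      using Ck_on_linear_compose[OF bounded_linear_mult_right[of "v *\<^sub>R \<i>"] open_UNIV Suc] by auto
  qed simp
qed

text \<open>Differentiation under the integral sign: the derivative of \<open>F\<close> in a
  direction \<open>(v, 0)\<close> is again an integrand on the same product, one order less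
  regular.\<close>

lemma Ck_on_integral:
  fixes F :: "'a::euclidean_space \<times> real \<Rightarrow> 'b::euclidean_space"
  assumes "open U" "Ck_on k (U \<times> UNIV) F"
  shows "Ck_on k U (\<lambda>x. integral {a..b} (\<lambda>t. F (x, t)))"
  using assms(2)
proof (induction k arbitrary: F)
  case 0
  then have "continuous_on (U \<times> cbox a b) (\<lambda>(x, t). F (x, t))"
    by (auto intro: continuous_on_subset)
  from integral_continuous_on_param[OF this] show ?case by (simp add: cbox_interval)
next
  case (Suc k)
  let ?D = "\<lambda>x t. frechet_derivative F (at (x, t))"
  \<comment> \<open>The Leibniz rule wants the partial derivative as a continuous map into bounded
    linear operators; in finite dimension continuity can be checked on basis vectors.\<close>
  define D where "D x t = Blinfun (\<lambda>v. ?D x t (v, 0))" for x t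
  have bl: "bounded_linear (\<lambda>v. ?D x t (v, 0))" if "x \<in> U" for x t
  proof (rule bounded_linear_compose[OF _ bounded_linear_Pair[OF bounded_linear_ident bounded_linear_zero]])
    show "bounded_linear (?D x t)"
      using Ck_on_differentiable[OF Suc.prems] that by (blast intro: has_derivative_bounded_linear)
  qed
  have D: "blinfun_apply (D x t) v = ?D x t (v, 0)" if "x \<in> U" for x t v
    using bounded_linear_Blinfun_apply[OF bl[OF that]] by (simp add: D_def)
  have CkD: "Ck_on k (U \<times> UNIV) (\<lambda>y. frechet_derivative F (at y) v)" for v
    using Suc.prems by (simp only: Ck_on.simps)
  have contD: "continuous_on (U \<times> UNIV) (\<lambda>y. frechet_derivative F (at y) v)" for v
  proof -
    have "Ck_on 0 (U \<times> UNIV) (\<lambda>y. frechet_derivative F (at y) v)"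
      using CkD[of v] by (induction k) (auto simp del: Ck_on.simps intro: Ck_on_Suc_imp)
    then show ?thesis by simp
  qed
  have cont: "continuous_on (U \<times> cbox a b) (\<lambda>(x, t). D x t)"
  proof (rule continuous_on_blinfun_componentwise)
    fix i :: 'a assume "i \<in> Basis"
    have "continuous_on (U \<times> cbox a b) (\<lambda>y. frechet_derivative F (at y) (i, 0))"
      by (rule continuous_on_subset[OF contD]) auto
    then show "continuous_on (U \<times> cbox a b) (\<lambda>y. blinfun_apply (case y of (x, t) \<Rightarrow> D x t) i)"
      by (rule continuous_on_eq) (auto simp: D)
  qed
  have contF: "continuous_on (U \<times> UNIV) F"
    using Suc.prems by (auto intro: differentiable_imp_continuous_on differentiable_at_imp_differentiable_on)
  have int: "(\<lambda>t. F (x, t)) integrable_on cbox a b" if "x \<in> U" for x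
    by (intro integrable_continuous continuous_on_compose2[OF contF] continuous_intros) (use that in auto)
  have intD: "(\<lambda>t. D x t) integrable_on cbox a b" if "x \<in> U" for x
  proof (intro integrable_continuous)
    show "continuous_on (cbox a b) (D x)"
    proof -
      have c: "continuous_on (cbox a b) (Pair x)"
        by (intro continuous_intros)
      have "Pair x ` cbox a b \<subseteq> U \<times> cbox a b"
        using that by auto
      from continuous_on_compose2[OF cont c this] show ?thesis by (simp only: prod.case)
    qed
  qed
  have fx: "((\<lambda>x. F (x, t)) has_derivative blinfun_apply (D x t)) (at x)" if "x \<in> U" for x t
  proof -
    have "((\<lambda>x. (x, t)) has_derivative (\<lambda>v. (v, 0))) (at x)"
      by (auto intro!: derivative_eq_intros)
    then have "((\<lambda>x. F (x, t)) has_derivative (\<lambda>v. ?D x t (v, 0))) (at x)"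
      using has_derivative_compose[OF _ Ck_on_differentiable[OF Suc.prems]] that by force
    then show ?thesis using D[OF that] by presburger
  qed
  show ?case
  proof (rule Ck_on_SucI[OF assms(1)])
    show "((\<lambda>x. integral {a..b} (\<lambda>t. F (x, t))) has_derivative
        (\<lambda>v. integral {a..b} (\<lambda>t. ?D x t (v, 0)))) (at x)" if xU: "x \<in> U" for x
    proof -
      \<comment> \<open>The Leibniz rule needs a convex parameter domain, hence a ball inside
        \<open>U\<close>.\<close>
      obtain e where e: "e > 0" "ball x e \<subseteq> U" using openE[OF assms(1) xU] by metis
      have x: "x \<in> ball x e" using e by simp
      have "((\<lambda>x. integral (cbox a b) (\<lambda>t. F (x, t))) has_derivative integral (cbox a b) (D x))
          (at x within ball x e)"
      proof (rule leibniz_rule)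
        show "((\<lambda>x. F (x, t)) has_derivative blinfun_apply (D y t)) (at y within ball x e)"
          if "y \<in> ball x e" for y t
          using fx[of y t] e that has_derivative_at_withinI by blast
        show "(\<lambda>t. F (y, t)) integrable_on cbox a b" if "y \<in> ball x e" for y
          using int e that by blast
        show "continuous_on (ball x e \<times> cbox a b) (\<lambda>(x, t). D x t)"
          by (rule continuous_on_subset[OF cont]) (use e in blast)
      qed (use x in auto)
      moreover have "blinfun_apply (integral (cbox a b) (D x)) = (\<lambda>v. integral (cbox a b) (\<lambda>t. ?D x t (v, 0)))"
        using D[OF xU] blinfun_apply_integral[OF intD[OF xU]]
        by (simp add: fun_eq_iff)
      ultimately show ?thesis
        using at_within_open[OF x open_ball] by (simp add: cbox_interval)
    qed
    show "Ck_on k U (\<lambda>x. integral {a..b} (\<lambda>t. ?D x t (v, 0)))" for v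
      using Suc.IH[OF CkD[of "(v, 0)"]] by simp
  qed
qed


section \<open>Smooth maps on arbitrary subsets\<close>

lemma smooth_on_open_iff: "open U \<Longrightarrow> smooth_on U f \<longleftrightarrow> (\<forall>k. Ck_on k U f)"
proof (intro iffI allI)
  fix k assume U: "open U" and f: "smooth_on U f"
  show "Ck_on k U f"
  proof (rule Ck_on_local)
    fix x assume "x \<in> U"
    then obtain N g where N: "open N" "x \<in> N" "\<forall>k. Ck_on k N g" "\<forall>y\<in>N \<inter> U. g y = f y"
      using f unfolding smooth_on_def by blast
    have "Ck_on k (N \<inter> U) f"
      by (rule Ck_on_cong[of _ g]) (use N U in \<open>auto intro: Ck_on_subset\<close>)
    then show "\<exists>N. open N \<and> x \<in> N \<and> Ck_on k N f"
      using N U \<open>x \<in> U\<close> by blast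
  qed
next
  assume "open U" "\<forall>k. Ck_on k U f"
  then show "smooth_on U f" unfolding smooth_on_def by blast
qed

lemma smooth_on_openI: "open U \<Longrightarrow> (\<And>k. Ck_on k U f) \<Longrightarrow> smooth_on U f"
  by (simp add: smooth_on_open_iff)

lemma smooth_onE:
  assumes "smooth_on M f" "x \<in> M"
  obtains U g where "open U" "x \<in> U" "smooth_on U g" "\<And>y. y \<in> U \<inter> M \<Longrightarrow> g y = f y"
  using assms smooth_on_open_iff unfolding smooth_on_def by metis

lemma smooth_onI:
  assumes "\<And>x. x \<in> M \<Longrightarrow> \<exists>U g. open U \<and> x \<in> U \<and> smooth_on U g \<and> (\<forall>y\<in>U \<inter> M. g y = f y)"
  shows "smooth_on M f"
  unfolding smooth_on_def
proof
  fix x assume "x \<in> M"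
  then obtain U g where "open U" "x \<in> U" "smooth_on U g" "\<forall>y\<in>U \<inter> M. g y = f y"
    using assms by meson
  then show "\<exists>U g. open U \<and> x \<in> U \<and> (\<forall>k. Ck_on k U g) \<and> (\<forall>y\<in>U \<inter> M. g y = f y)"
    using smooth_on_open_iff by (intro exI[of _ U] exI[of _ g]) auto
qed

lemma smooth_on_subset:
  assumes "smooth_on M f" "N \<subseteq> M"
  shows "smooth_on N f"
proof (rule smooth_onI)
  fix x assume "x \<in> N"
  then obtain U g where "open U" "x \<in> U" "smooth_on U g" "\<And>y. y \<in> U \<inter> M \<Longrightarrow> g y = f y"
    using smooth_onE[OF assms(1), of x] assms(2) by auto
  then show "\<exists>U g. open U \<and> x \<in> U \<and> smooth_on U g \<and> (\<forall>y\<in>U \<inter> N. g y = f y)"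
    using assms(2) by (intro exI[of _ U] exI[of _ g]) auto
qed

lemma smooth_on_cong:
  assumes "smooth_on M f" "\<And>x. x \<in> M \<Longrightarrow> f x = g x"
  shows "smooth_on M g"
proof (rule smooth_onI)
  fix x assume "x \<in> M"
  then obtain U h where "open U" "x \<in> U" "smooth_on U h" "\<And>y. y \<in> U \<inter> M \<Longrightarrow> h y = f y"
    using smooth_onE[OF assms(1), of x] by auto
  then show "\<exists>U h. open U \<and> x \<in> U \<and> smooth_on U h \<and> (\<forall>y\<in>U \<inter> M. h y = g y)"
    using assms(2) by (intro exI[of _ U] exI[of _ h]) auto
qed

lemma smooth_on_imp_continuous_on:
  assumes "smooth_on M f"
  shows "continuous_on M f"
  unfolding continuous_on_eq_continuous_within
proof
  fix x assume x: "x \<in> M"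
  then obtain U g where U: "open U" "x \<in> U" "\<forall>k. Ck_on k U g" "\<forall>y\<in>U \<inter> M. g y = f y"
    using assms unfolding smooth_on_def by blast
  have "continuous_on U g" using U(3) Ck_on.simps(1) by blast
  then have "continuous (at x within M) g"
    using U by (meson continuous_at_imp_continuous_at_within continuous_on_eq_continuous_at)
  moreover have "\<forall>\<^sub>F y in at x within M. g y = f y"
    unfolding eventually_at_topological using U by blast
  ultimately show "continuous (at x within M) f"
    unfolding continuous_within using U x tendsto_cong by fastforce
qed

lemma smooth_on_const: "smooth_on M (\<lambda>x. c)"
  by (rule smooth_on_subset[OF smooth_on_openI[of UNIV]]) (auto intro: Ck_on_const)

lemma smooth_on_bounded_linear: "bounded_linear f \<Longrightarrow> smooth_on M f"
  by (rule smooth_on_subset[OF smooth_on_openI[of UNIV]]) (auto intro: Ck_on_bounded_linear)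

lemma smooth_on_ident: "smooth_on M (\<lambda>x. x)"
  by (rule smooth_on_bounded_linear[OF bounded_linear_ident])

lemma smooth_on_compose:
  fixes g :: "'a::real_normed_vector \<Rightarrow> 'b::euclidean_space"
  assumes "smooth_on N f" "smooth_on M g" "g ` M \<subseteq> N"
  shows "smooth_on M (\<lambda>x. f (g x))"
proof (rule smooth_onI)
  fix x assume x: "x \<in> M"
  obtain U h where U: "open U" "x \<in> U" "smooth_on U h" "\<And>y. y \<in> U \<inter> M \<Longrightarrow> h y = g y"
    using smooth_onE[OF assms(2) x] by blast
  obtain V k where V: "open V" "g x \<in> V" "smooth_on V k" "\<And>y. y \<in> V \<inter> N \<Longrightarrow> k y = f y"
    using smooth_onE[OF assms(1), of "g x"] assms(3) x by blast
  let ?W = "U \<inter> h -` V"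
  have W: "open ?W"
    using U V smooth_on_imp_continuous_on by (metis continuous_on_open_vimage inf_commute)
  have "smooth_on ?W (\<lambda>x. k (h x))"
  proof (rule smooth_on_openI[OF W])
    fix n
    have "Ck_on n ?W h"
      by (rule Ck_on_subset[where U = U]) (use U smooth_on_open_iff in auto)
    moreover have "Ck_on n V k"
      using V smooth_on_open_iff by auto
    ultimately show "Ck_on n ?W (\<lambda>x. k (h x))"
      using Ck_on_compose[OF W V(1), of h n k] by blast
  qed
  moreover have "x \<in> ?W" "\<forall>y\<in>?W \<inter> M. k (h y) = f (g y)"
    using U V assms(3) x by auto
  ultimately show "\<exists>U l. open U \<and> x \<in> U \<and> smooth_on U l \<and> (\<forall>y\<in>U \<inter> M. l y = f (g y))"
    by (intro exI[of _ ?W] exI[of _ "\<lambda>y. k (h y)"]) (use W in simp)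
qed

text \<open>Two local extensions may live on different neighbourhoods, so they are combined on the
  intersection. A \<open>B\<close> that ignores its second argument yields post-composition, as in
  \<open>smooth_on_linear\<close>.\<close>

lemma smooth_on_combine:
  fixes M :: "'a::real_normed_vector set"
  assumes "smooth_on M f" "smooth_on M g"
    "\<And>(U :: 'a set) k f g. open U \<Longrightarrow> Ck_on k U f \<Longrightarrow> Ck_on k U g \<Longrightarrow> Ck_on k U (\<lambda>x. B (f x) (g x))"
  shows "smooth_on M (\<lambda>x. B (f x) (g x))"
proof (rule smooth_onI)
  fix x assume x: "x \<in> M"
  obtain U h where U: "open U" "x \<in> U" "smooth_on U h" "\<And>y. y \<in> U \<inter> M \<Longrightarrow> h y = f y"
    using smooth_onE[OF assms(1) x] by blast
  obtain V k where V: "open V" "x \<in> V" "smooth_on V k" "\<And>y. y \<in> V \<inter> M \<Longrightarrow> k y = g y"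
    using smooth_onE[OF assms(2) x] by blast
  have "smooth_on (U \<inter> V) (\<lambda>x. B (h x) (k x))"
  proof (rule smooth_on_openI)
    show "open (U \<inter> V)" using U V by blast
    show "Ck_on n (U \<inter> V) (\<lambda>x. B (h x) (k x))" for n
    proof (rule assms(3))
      show "open (U \<inter> V)" using U V by blast
      show "Ck_on n (U \<inter> V) h" "Ck_on n (U \<inter> V) k"
          using U V by (auto simp: smooth_on_open_iff intro: Ck_on_subset)
    qed
  qed
  then show "\<exists>U l. open U \<and> x \<in> U \<and> smooth_on U l \<and> (\<forall>y\<in>U \<inter> M. l y = B (f y) (g y))"
    using U V by (intro exI[of _ "U \<inter> V"] exI[of _ "\<lambda>x. B (h x) (k x)"]) auto
qed

lemma smooth_on_bilinear:
  assumes "bounded_bilinear B" "smooth_on M f" "smooth_on M g"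
  shows "smooth_on M (\<lambda>x. B (f x) (g x))"
  by (rule smooth_on_combine[OF assms(2,3) Ck_on_bounded_bilinear[OF assms(1)]])

lemma smooth_on_add: "smooth_on M f \<Longrightarrow> smooth_on M g \<Longrightarrow> smooth_on M (\<lambda>x. f x + g x)"
  by (rule smooth_on_combine[where B = "(+)"]) (auto intro: Ck_on_add)

lemma smooth_on_linear:
  assumes "bounded_linear h" "smooth_on M f"
  shows "smooth_on M (\<lambda>x. h (f x))"
  by (rule smooth_on_combine[where B = "\<lambda>a b. h a", OF assms(2) assms(2)])
    (rule Ck_on_linear_compose[OF assms(1)])

lemma smooth_on_diff: 
  assumes "smooth_on M f" "smooth_on M g"
  shows "smooth_on M (\<lambda>x. f x - g x)"
  using smooth_on_add[OF assms(1) smooth_on_linear[OF bounded_linear_minus[OF bounded_linear_ident] assms(2)]]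
  by simp

lemma smooth_on_Pair:
  assumes "smooth_on M f" "smooth_on M g"
  shows "smooth_on M (\<lambda>x. (f x, g x))"
proof -
  have "smooth_on M (\<lambda>x. (f x, 0) + (0, g x))"
    by (intro smooth_on_add smooth_on_linear[OF _ assms(1)] smooth_on_linear[OF _ assms(2)]
        bounded_linear_intros)
  then show ?thesis by simp
qed

lemmas smooth_on_mult = smooth_on_bilinear[OF bounded_bilinear_mult]
lemmas smooth_on_scaleR = smooth_on_bilinear[OF bounded_bilinear_scaleR]
lemmas smooth_on_inner = smooth_on_bilinear[OF bounded_bilinear_inner]
lemmas smooth_on_of_real = smooth_on_linear[OF bounded_linear_of_real]
lemmas smooth_on_fst = smooth_on_linear[OF bounded_linear_fst]
lemmas smooth_on_snd = smooth_on_linear[OF bounded_linear_snd]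
lemmas smooth_on_cnj = smooth_on_linear[OF bounded_linear_cnj]
lemmas smooth_on_Im = smooth_on_linear[OF bounded_linear_Im]

lemma smooth_on_inverse:
  fixes f :: "'a::real_normed_vector \<Rightarrow> real"
  assumes "smooth_on M f" "\<And>x. x \<in> M \<Longrightarrow> f x \<noteq> 0"
  shows "smooth_on M (\<lambda>x. inverse (f x))"
proof (rule smooth_on_compose[OF _ assms(1)])
  show "smooth_on (- {0}) (inverse :: real \<Rightarrow> real)"
    using Ck_on_inverse by (intro smooth_on_openI open_Compl) auto
qed (use assms(2) in auto)

lemma smooth_on_sqrt:
  assumes "smooth_on M f" "\<And>x. x \<in> M \<Longrightarrow> f x > 0"
  shows "smooth_on M (\<lambda>x. sqrt (f x))"
proof (rule smooth_on_compose[OF _ assms(1)])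
  show "smooth_on {0<..} sqrt"
    using Ck_on_sqrt by (intro smooth_on_openI) auto
qed (use assms(2) in auto)

lemma smooth_on_cis:
  assumes "smooth_on M f"
  shows "smooth_on M (\<lambda>x. cis (f x))"
  by (rule smooth_on_compose[OF smooth_on_openI[OF open_UNIV Ck_on_cis] assms]) auto

lemma smooth_on_norm:
  fixes f :: "'a::real_normed_vector \<Rightarrow> 'b::euclidean_space"
  assumes "smooth_on M f" "\<And>x. x \<in> M \<Longrightarrow> f x \<noteq> 0"
  shows "smooth_on M (\<lambda>x. norm (f x))"
  unfolding norm_eq_sqrt_inner
  by (intro smooth_on_sqrt smooth_on_inner) (use assms in auto)

lemma smooth_on_sgn:
  fixes f :: "'a::real_normed_vector \<Rightarrow> 'b::euclidean_space"
  assumes "smooth_on M f" "\<And>x. x \<in> M \<Longrightarrow> f x \<noteq> 0"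
  shows "smooth_on M (\<lambda>x. sgn (f x))"
  unfolding sgn_div_norm
  by (intro smooth_on_scaleR smooth_on_inverse smooth_on_norm) (use assms in auto)

lemma smooth_on_derivative:
  assumes "open U" "smooth_on U f"
  shows "x \<in> U \<Longrightarrow> (f has_derivative frechet_derivative f (at x)) (at x)"
    and "smooth_on U (\<lambda>x. frechet_derivative f (at x) v)"
proof -
  have "Ck_on (Suc k) U f" for k
    using assms smooth_on_open_iff by blast
  then show "x \<in> U \<Longrightarrow> (f has_derivative frechet_derivative f (at x)) (at x)"
    "smooth_on U (\<lambda>x. frechet_derivative f (at x) v)"
    using assms(1) by (auto intro: smooth_on_openI simp: frechet_derivative_works)
qed

lemma smooth_on_integral:
  fixes F :: "'a::euclidean_space \<Rightarrow> real \<Rightarrow> 'b::euclidean_space"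
  assumes "open U" "smooth_on (U \<times> UNIV) (\<lambda>(x, t). F x t)"
  shows "smooth_on U (\<lambda>x. integral {a..b} (F x))"
proof (rule smooth_on_openI[OF assms(1)])
  fix k
  have "Ck_on k (U \<times> UNIV) (\<lambda>(x, t). F x t)"
    using assms open_Times smooth_on_open_iff by blast
  from Ck_on_integral[OF assms(1) this, of a b]
  show "Ck_on k U (\<lambda>x. integral {a..b} (F x))" by simp
qed


section \<open>Inverses of small perturbations of the identity\<close>

text \<open>A product rule in which \<open>q\<close> is only continuous: since \<open>p\<close>
  vanishes at \<open>x\<close>, the increment of \<open>q\<close> is multiplied by something already
  of first order. It serves for inverse operators, where differentiability of \<open>q\<close> is
  what is being proved.\<close>

lemma has_derivative_scaleR_vanishing:
  fixes p :: "'a::real_normed_vector \<Rightarrow> real" and q :: "'a \<Rightarrow> 'b::real_normed_vector"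
  assumes p: "(p has_derivative p') (at x)" and px: "p x = 0" and q: "isCont q x"
  shows "((\<lambda>y. p y *\<^sub>R q y) has_derivative (\<lambda>u. p' u *\<^sub>R q x)) (at x)"
  unfolding has_derivative_at2
proof
  have bl: "bounded_linear p'" using p by (rule has_derivative_bounded_linear)
  show "bounded_linear (\<lambda>u. p' u *\<^sub>R q x)"
    by (rule bounded_linear_scaleR_const[OF bl])
  have 1: "((\<lambda>y. (1 / norm (y - x)) *\<^sub>R (p y - (p x + p' (y - x)))) \<longlongrightarrow> 0) (at x)"
    using p by (simp add: has_derivative_at2)
  have 2: "(q \<longlongrightarrow> q x) (at x)" using q by (simp add: isCont_def)
  have 3: "((\<lambda>y. norm ((1 / norm (y - x)) *\<^sub>R (p y - (p x + p' (y - x)))) * norm (q y)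
      + onorm p' * norm (q y - q x)) \<longlongrightarrow> 0) (at x)"
  proof -
    have "((\<lambda>y. norm ((1 / norm (y - x)) *\<^sub>R (p y - (p x + p' (y - x)))) * norm (q y)
      + onorm p' * norm (q y - q x)) \<longlongrightarrow> norm (0::real) * norm (q x) + onorm p' * norm (q x - q x)) (at x)"
      by (intro tendsto_intros 1 2)
    then show ?thesis by simp
  qed
  show "((\<lambda>y. (1 / norm (y - x)) *\<^sub>R (p y *\<^sub>R q y - (p x *\<^sub>R q x + p' (y - x) *\<^sub>R q x))) \<longlongrightarrow> 0) (at x)"
  proof (rule Lim_null_comparison[OF always_eventually 3], rule allI)
    fix y
    let ?n = "1 / norm (y - x)"
    have bnd: "\<bar>?n * p' (y - x)\<bar> \<le> onorm p'"
      using onorm[OF bl, of "y - x"] onorm_pos_le[OF bl]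
      by (cases "y = x") (auto simp: abs_mult divide_simps)
    have "?n *\<^sub>R (p y *\<^sub>R q y - (p x *\<^sub>R q x + p' (y - x) *\<^sub>R q x)) =
        (?n *\<^sub>R (p y - (p x + p' (y - x)))) *\<^sub>R q y + (?n * p' (y - x)) *\<^sub>R (q y - q x)"
      by (simp add: px algebra_simps)
    also have "norm \<dots> \<le> norm (?n *\<^sub>R (p y - (p x + p' (y - x)))) * norm (q y)
        + \<bar>?n * p' (y - x)\<bar> * norm (q y - q x)"
      by (rule order_trans[OF norm_triangle_ineq]) simp
    also have "\<dots> \<le> norm (?n *\<^sub>R (p y - (p x + p' (y - x)))) * norm (q y) + onorm p' * norm (q y - q x)"
      using bnd by (intro add_left_mono mult_right_mono) auto
    finally show "norm (?n *\<^sub>R (p y *\<^sub>R q y - (p x *\<^sub>R q x + p' (y - x) *\<^sub>R q x))) \<le>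
        norm (?n *\<^sub>R (p y - (p x + p' (y - x)))) * norm (q y) + onorm p' * norm (q y - q x)" .
  qed
qed

text \<open>Inversion of operators preserves regularity, shown without determinants from
  \<open>B x - B x0 = - B x (A x - A x0) B x0\<close>. The uniform bound \<open>C\<close> turns this
  identity into continuity; the derivative - B A' B is then built from \<open>B\<close> and A',
  which keeps the induction running.\<close>

lemma Ck_on_operator_inverse:
  fixes A B :: "'a::real_normed_vector \<Rightarrow> 'b::euclidean_space \<Rightarrow> 'b"
  assumes U: "open U" and A: "\<And>w. Ck_on k U (\<lambda>x. A x w)"
    and lin: "\<And>x. x \<in> U \<Longrightarrow> linear (A x)" "\<And>x. x \<in> U \<Longrightarrow> linear (B x)"
    and inv: "\<And>x v. x \<in> U \<Longrightarrow> A x (B x v) = v" "\<And>x v. x \<in> U \<Longrightarrow> B x (A x v) = v"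
    and bound: "\<And>x v. x \<in> U \<Longrightarrow> norm (B x v) \<le> C * norm v"
  shows "Ck_on k U (\<lambda>x. B x v)"
  using A
proof (induction k arbitrary: v)
  case 0
  have "isCont (\<lambda>x. B x v) x0" if x0: "x0 \<in> U" for x0
  proof -
    define w where "w = B x0 v"
    have "continuous_on U (\<lambda>x. A x w)" using 0 by simp
    then have "((\<lambda>x. A x w) \<longlongrightarrow> A x0 w) (at x0)"
      using U x0 continuous_on_eq_continuous_at isCont_def by blast
    then have "((\<lambda>x. C * norm (A x0 w - A x w)) \<longlongrightarrow> C * norm (A x0 w - A x0 w)) (at x0)"
      by (intro tendsto_intros)
    then have lim: "((\<lambda>x. C * norm (A x0 w - A x w)) \<longlongrightarrow> 0) (at x0)" by simp
    have "norm (B x v - B x0 v) \<le> C * norm (A x0 w - A x w)" if x: "x \<in> U" for x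
    proof -
      have "B x (A x0 w - A x w) = B x v - B x0 v"
        using inv x x0 by (simp add: linear_diff[OF lin(2)] w_def)
      then show ?thesis using bound[OF x] by metis
    qed
    then have "\<forall>\<^sub>F x in at x0. norm (B x v - B x0 v) \<le> C * norm (A x0 w - A x w)"
      using U x0 by (auto simp: eventually_at_topological)
    from Lim_null_comparison[OF this lim] show ?thesis
      by (simp add: isCont_def LIM_zero_iff)
  qed
  then show ?case by (simp add: continuous_at_imp_continuous_on)
next
  case (Suc k)
  let ?D = "\<lambda>c x. frechet_derivative (\<lambda>x. A x c) (at x)"
  have CkB: "Ck_on k U (\<lambda>x. B x v)" for v
    by (rule Suc.IH[OF Ck_on_Suc_imp[OF Suc.prems]])
  have contB: "isCont (\<lambda>x. B x v) x0" if "x0 \<in> U" for x0 v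
  proof -
    have "Ck_on 0 U (\<lambda>x. B x v)"
      using CkB[of v] by (induction k) (auto simp del: Ck_on.simps intro: Ck_on_Suc_imp)
    then show ?thesis using U that continuous_on_eq_continuous_at by auto
  qed
  have derA: "((\<lambda>x. A x w) has_derivative (\<lambda>u. \<Sum>c\<in>Basis. (w \<bullet> c) *\<^sub>R ?D c x0 u)) (at x0)"
    if x0: "x0 \<in> U" for x0 w
  proof (rule has_derivative_transform_within_open[OF _ U x0])
    show "((\<lambda>x. \<Sum>c\<in>Basis. (w \<bullet> c) *\<^sub>R A x c) has_derivative
        (\<lambda>u. \<Sum>c\<in>Basis. (w \<bullet> c) *\<^sub>R ?D c x0 u)) (at x0)"
      by (intro has_derivative_sum has_derivative_scaleR_right Ck_on_differentiable[OF Suc.prems] x0)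
    show "(\<Sum>c\<in>Basis. (w \<bullet> c) *\<^sub>R A x c) = A x w" if "x \<in> U" for x
      by (rule linear_basis_expansion[OF lin(1)[OF that], symmetric])
  qed
  let ?B' = "\<lambda>x0 u. - (\<Sum>b\<in>Basis. ((\<Sum>c\<in>Basis. (B x0 v \<bullet> c) *\<^sub>R ?D c x0 u) \<bullet> b) *\<^sub>R B x0 b)"
  show ?case
  proof (rule Ck_on_SucI[OF U])
    fix x0 assume x0: "x0 \<in> U"
    \<comment> \<open>Since \<open>A x0 w = v\<close>,
      \<open>B x v = B x0 v - B x (A x w - A x0 w)\<close>. Written in a basis, each correction term
      is a coefficient vanishing at \<open>x0\<close> times a continuous function.\<close>
    define w where "w = B x0 v"
    have "((\<lambda>x. B x0 v - (\<Sum>b\<in>Basis. ((A x w - A x0 w) \<bullet> b) *\<^sub>R B x b)) has_derivative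
        (\<lambda>u. 0 - (\<Sum>b\<in>Basis. ((\<Sum>c\<in>Basis. (w \<bullet> c) *\<^sub>R ?D c x0 u) \<bullet> b) *\<^sub>R B x0 b))) (at x0)"
    proof (intro has_derivative_diff has_derivative_const has_derivative_sum has_derivative_scaleR_vanishing)
      fix b :: 'b
      have "((\<lambda>x. A x w - A x0 w) has_derivative (\<lambda>u. (\<Sum>c\<in>Basis. (w \<bullet> c) *\<^sub>R ?D c x0 u) - 0)) (at x0)"
        by (intro has_derivative_diff has_derivative_const derA x0)
      from has_derivative_inner_left[OF this, of b]
      show "((\<lambda>x. (A x w - A x0 w) \<bullet> b) has_derivative
          (\<lambda>u. (\<Sum>c\<in>Basis. (w \<bullet> c) *\<^sub>R ?D c x0 u) \<bullet> b)) (at x0)" by simp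
    qed (use contB x0 in auto)
    then have "((\<lambda>x. B x0 v - (\<Sum>b\<in>Basis. ((A x w - A x0 w) \<bullet> b) *\<^sub>R B x b)) has_derivative ?B' x0) (at x0)"
      by (simp add: w_def)
    then show "((\<lambda>x. B x v) has_derivative ?B' x0) (at x0)"
    proof (rule has_derivative_transform_within_open[OF _ U x0])
      fix x assume x: "x \<in> U"
      have "(\<Sum>b\<in>Basis. ((A x w - A x0 w) \<bullet> b) *\<^sub>R B x b) = B x (A x w - A x0 w)"
        by (rule linear_basis_expansion[OF lin(2)[OF x], symmetric])
      also have "\<dots> = w - B x v"
        using inv x x0 by (simp add: linear_diff[OF lin(2)] w_def)
      finally show "B x0 v - (\<Sum>b\<in>Basis. ((A x w - A x0 w) \<bullet> b) *\<^sub>R B x b) = B x v"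
        by (simp add: w_def)
    qed
  next
    fix u
    have D: "Ck_on k U (\<lambda>x. ?D c x u)" for c
      using Suc.prems[of c] by simp
    show "Ck_on k U (\<lambda>x. ?B' x u)"
      by (intro Ck_on_linear_compose[OF bounded_linear_minus[OF bounded_linear_ident]] U Ck_on_sum
          Ck_on_bounded_bilinear[OF bounded_bilinear_scaleR] CkB D
          Ck_on_linear_compose[OF bounded_linear_inner_left])
  qed
qed

text \<open>Solving \<open>x + G x = y\<close> means finding a fixed point of the contraction x -> y
  - G x.\<close>

lemma bij_perturbation_of_identity:
  fixes G :: "'a::euclidean_space \<Rightarrow> 'a"
  assumes "0 \<le> c" "c < 1" "\<And>x y. norm (G x - G y) \<le> c * norm (x - y)"
  shows "bij (\<lambda>x. x + G x)"
  unfolding bij_iff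
proof
  fix y
  have "\<exists>!x. y - G x = x"
    by (rule banach_fix_type[OF assms(1,2)])
      (use assms(3) in \<open>simp add: dist_norm norm_minus_commute\<close>)
  then show "\<exists>!x. x + G x = y"
    by (metis add_diff_cancel_right' diff_add_cancel)
qed

text \<open>A global inverse function theorem. The perturbation shrinks no distance by more than the
  factor \<open>1 - c\<close>, so its inverse is Lipschitz; the same estimate for the derivative
  makes that derivative injective, hence invertible in finite dimension. \<open>U\<close> is kept
  separate because \<open>G\<close> will be smooth only away from the origin.\<close>

lemma smooth_inverse_perturbation_of_identity:
  fixes G :: "'a::euclidean_space \<Rightarrow> 'a"
  assumes c: "0 \<le> c" "c < 1" and Lip: "\<And>x y. norm (G x - G y) \<le> c * norm (x - y)"
    and U: "open U" and G: "smooth_on U G"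
    and bound: "\<And>x v. x \<in> U \<Longrightarrow> norm (frechet_derivative G (at x) v) \<le> c * norm v"
  defines "\<Phi> \<equiv> \<lambda>x. x + G x"
  shows "open (\<Phi> ` U)" "smooth_on (\<Phi> ` U) (inv \<Phi>)"
proof -
  have bij: "bij \<Phi>" unfolding \<Phi>_def by (rule bij_perturbation_of_identity[OF c Lip])
  have \<Phi>inv: "\<Phi> (inv \<Phi> y) = y" and inv\<Phi>: "inv \<Phi> (\<Phi> x) = x" for x y
    using bij by (auto simp: bij_is_surj surj_f_inv_f bij_is_inj)
  have expand: "(1 - c) * norm (x - y) \<le> norm (\<Phi> x - \<Phi> y)" for x y
    using Lip[of x y] norm_triangle_ineq4[of "\<Phi> x - \<Phi> y" "G x - G y"]
    by (simp add: \<Phi>_def algebra_simps)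
  have "dist (inv \<Phi> y) (inv \<Phi> z) \<le> 1 / (1 - c) * dist y z" for y z
    using expand[of "inv \<Phi> y" "inv \<Phi> z"] c by (simp add: dist_norm \<Phi>inv field_simps)
  then have "(1 / (1 - c))-lipschitz_on UNIV (inv \<Phi>)"
    using c by (intro lipschitz_onI) auto
  then have cont: "continuous_on UNIV (inv \<Phi>)"
    by (rule lipschitz_on_continuous_on)
  have image: "\<Phi> ` U = inv \<Phi> -` U"
    using bij_vimage_eq_inv_image[OF bij_imp_bij_inv[OF bij]] inv_inv_eq[OF bij] by metis
  show V: "open (\<Phi> ` U)"
    unfolding image using cont U by (rule open_vimage[rotated])
  define A where "A y w = w + frechet_derivative G (at (inv \<Phi> y)) w" for y w
  define B where "B y = inv (A y)" for y
  have der: "(\<Phi> has_derivative A y) (at (inv \<Phi> y))" if "y \<in> \<Phi> ` U" for y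
    using that unfolding \<Phi>_def[abs_def] A_def[abs_def]
    by (intro has_derivative_add has_derivative_ident smooth_on_derivative(1)[OF U G])
      (use image[unfolded \<Phi>_def] in auto)
  have linA: "linear (A y)" if "y \<in> \<Phi> ` U" for y
    using der[OF that] has_derivative_linear by blast
  have lower: "(1 - c) * norm w \<le> norm (A y w)" if "y \<in> \<Phi> ` U" for y w
  proof -
    have "norm (frechet_derivative G (at (inv \<Phi> y)) w) \<le> c * norm w"
      using that image by (intro bound) auto
    then show ?thesis
      using norm_triangle_ineq4[of "A y w" "frechet_derivative G (at (inv \<Phi> y)) w"]
      by (simp add: A_def algebra_simps)
  qed
  have bijA: "bij (A y)" if "y \<in> \<Phi> ` U" for y
  proof -
    have "w = 0" if "A y w = 0" for w
      using lower[OF \<open>y \<in> \<Phi> ` U\<close>, of w] that c by (simp add: mult_le_0_iff)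
    then have "inj (A y)"
      using linA[OF that] linear_injective_0 by blast
    then show ?thesis
      using linA[OF that] linear_injective_imp_surjective bij_def by blast
  qed
  have AB: "A y (B y v) = v" and BA: "B y (A y v) = v" if "y \<in> \<Phi> ` U" for y v
    using bijA[OF that] by (auto simp: B_def bij_is_surj surj_f_inv_f bij_is_inj)
  have linB: "linear (B y)" if "y \<in> \<Phi> ` U" for y
    unfolding B_def using linA[OF that] bijA[OF that] by (simp add: inj_linear_imp_inv_linear bij_is_inj)
  have derinv: "(inv \<Phi> has_derivative B y) (at y)" if y: "y \<in> \<Phi> ` U" for y
  proof (rule has_derivative_inverse_basic[where g = "inv \<Phi>", OF der[OF y] _ _ _ V y])
    show "bounded_linear (B y)" using linB[OF y] by (simp add: linear_linear)
    show "B y \<circ> A y = id" using BA[OF y] by auto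
    show "isCont (inv \<Phi>) y" using cont continuous_on_eq_continuous_at by blast
  qed (rule \<Phi>inv)
  \<comment> \<open>The derivative \<open>B y\<close> of the inverse is the inverse operator of
    \<open>A y\<close>, and \<open>A y\<close> involves \<open>inv \<Phi>\<close> itself; order k of
    the inverse therefore yields order k + 1.\<close>
  have "Ck_on k (\<Phi> ` U) (inv \<Phi>)" for k
  proof (induction k)
    case 0
    then show ?case using continuous_on_subset[OF cont] by simp
  next
    case (Suc k)
    show ?case
    proof (rule Ck_on_SucI[OF V derinv])
      show "Ck_on k (\<Phi> ` U) (\<lambda>y. B y v)" for v
      proof (rule Ck_on_operator_inverse[OF V _ linA linB AB BA])
        show "Ck_on k (\<Phi> ` U) (\<lambda>y. A y w)" for w
          unfolding A_def
        proof (intro Ck_on_add Ck_on_const V)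
          have "Ck_on k U (\<lambda>x. frechet_derivative G (at x) w)"
            using smooth_on_derivative(2)[OF U G] U smooth_on_open_iff by blast
          from Ck_on_compose[OF V U _ Suc this]
          show "Ck_on k (\<Phi> ` U) (\<lambda>y. frechet_derivative G (at (inv \<Phi> y)) w)"
            using image by auto
        qed
        show "norm (B y v) \<le> 1 / (1 - c) * norm v" if "y \<in> \<Phi> ` U" for y v
          using lower[OF that, of "B y v"] AB[OF that] c by (simp add: field_simps)
      qed
    qed
  qed
  then show "smooth_on (\<Phi> ` U) (inv \<Phi>)"
    by (rule smooth_on_openI[OF V])
qed


section \<open>Quaternionic frames\<close>

lemma bounded_bilinear_qmult: "bounded_bilinear qmult"
proof
  show "\<exists>K. \<forall>a b. norm (qmult a b) \<le> norm a * norm b * K"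
    by (rule exI[of _ 1]) (simp add: norm_qmult)
qed (auto simp: qmult_def algebra_simps scaleR_conv_of_real)

lemmas qmult_simps =
  bounded_bilinear.add_left[OF bounded_bilinear_qmult]
  bounded_bilinear.add_right[OF bounded_bilinear_qmult]
  bounded_bilinear.scaleR_left[OF bounded_bilinear_qmult]
  bounded_bilinear.scaleR_right[OF bounded_bilinear_qmult]

lemma qmult_zero [simp]: "qmult 0 x = 0" "qmult x 0 = 0"
  by (simp_all add: qmult_def zero_prod_def)

lemma bounded_linear_qcnj: "bounded_linear qcnj"
proof (rule bounded_linear_intro[where K = 1])
  show "norm (qcnj x) \<le> norm x * 1" for x
    by (simp add: qcnj_def norm_prod_def)
qed (auto simp: qcnj_def)

lemma qmult_assoc: "qmult (qmult x y) z = qmult x (qmult y z)"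
  by (simp add: qmult_def algebra_simps)

lemma qcnj_qmult: "qcnj (qmult x y) = qmult (qcnj y) (qcnj x)"
  by (simp add: qmult_def qcnj_def algebra_simps)

lemma qmult_1 [simp]: "qmult x (1, 0) = x" "qmult (1, 0) x = x"
  by (simp_all add: qmult_def)

lemma norm_S3: "x \<in> S3 \<longleftrightarrow> norm x = 1"
  by (simp add: S3_def)

lemma S3_not_0: "x \<in> S3 \<Longrightarrow> x \<noteq> 0"
  by (auto simp: S3_def)

lemma qcnj_S3:
  assumes "x \<in> S3"
  shows "qmult x (qcnj x) = (1, 0)" "qmult (qcnj x) x = (1, 0)"
proof -
  have "(cmod (fst x))\<^sup>2 + (cmod (snd x))\<^sup>2 = 1"
    using assms by (simp add: S3_def norm_prod_def)
  then have "fst x * cnj (fst x) + snd x * cnj (snd x) = 1"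
    by (metis complex_norm_square of_real_1 of_real_add)
  then show "qmult x (qcnj x) = (1, 0)" "qmult (qcnj x) x = (1, 0)"
    by (auto simp: qmult_def qcnj_def algebra_simps)
qed

text \<open>Multiplication by a unit quaternion on either side is linear and preserves norms, hence
  inner products.\<close>

lemma inner_qmult:
  assumes "x \<in> S3"
  shows "qmult x a \<bullet> qmult x b = a \<bullet> b" "qmult a x \<bullet> qmult b x = a \<bullet> b"
proof -
  have polar: "f a \<bullet> f b = a \<bullet> b" if "linear f" "\<And>u. norm (f u) = norm u" for f :: "quat \<Rightarrow> quat"
    using that orthogonal_transformation orthogonal_transformation_def by blast
  show "qmult x a \<bullet> qmult x b = a \<bullet> b"
    by (rule polar[OF bounded_linear.linear[OF bounded_bilinear.bounded_linear_right[OF bounded_bilinear_qmult]]])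
      (use assms in \<open>simp add: norm_qmult norm_S3\<close>)
  show "qmult a x \<bullet> qmult b x = a \<bullet> b"
    by (rule polar[OF bounded_linear.linear[OF bounded_bilinear.bounded_linear_left[OF bounded_bilinear_qmult]]])
      (use assms in \<open>simp add: norm_qmult norm_S3\<close>)
qed

lemma qmult_S3: "x \<in> S3 \<Longrightarrow> y \<in> S3 \<Longrightarrow> qmult x y \<in> S3"
  by (simp add: norm_S3 norm_qmult)

lemma cis_S3 [simp]: "(cis t, 0) \<in> S3"
  by (simp add: norm_S3 norm_Pair)

lemma hopf_circle_S3: "x \<in> S3 \<Longrightarrow> hopf_circle x t \<in> S3"
  by (simp add: hopf_circle_def qmult_S3)

lemma hopf_circle_add: "hopf_circle (hopf_circle x s) t = hopf_circle x (s + t)"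
  by (simp add: hopf_circle_def qmult_assoc) (simp add: qmult_def cis_mult)

lemma hopf_hopf_circle: "x \<in> S3 \<Longrightarrow> hopf (hopf_circle x t) = hopf x"
proof -
  have "qmult (qmult (cis t, 0) (\<i>, 0)) (qcnj (cis t, 0)) = (\<i>, 0)"
    by (simp add: qmult_def qcnj_def cis_cnj mult.commute[of _ "\<i>"] mult.assoc cis_mult)
  then show ?thesis
    by (simp add: hopf_def hopf_circle_def qcnj_qmult) (metis qmult_assoc)
qed

lemma hopf_eq_iff:
  assumes "x \<in> S3" "y \<in> S3"
  shows "hopf y = hopf x \<longleftrightarrow> (\<exists>t. y = hopf_circle x t)"
  using hopf_fiber_eq[OF assms(1)] assms hopf_hopf_circle[OF assms(1)] by (force simp: hopf_fiber_def)

lemma hopf_coords: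
  "hopf (z, w) = (\<i> * (z * cnj z - w * cnj w), 2 * \<i> * (cnj z * w))"
  by (simp add: hopf_def qmult_def qcnj_def algebra_simps)

lemma has_derivative_hopf:
  "(hopf has_derivative (\<lambda>v. qmult (qmult x (\<i>, 0)) (qcnj v) + qmult (qmult v (\<i>, 0)) (qcnj x))) (at x)"
proof -
  have "((\<lambda>x. qmult (qmult x (\<i>, 0)) (qcnj x)) has_derivative
     (\<lambda>v. qmult (qmult x (\<i>, 0)) (qcnj v) + qmult (qmult v (\<i>, 0)) (qcnj x))) (at x)"
    by (intro bounded_bilinear.FDERIV[OF bounded_bilinear_qmult]
        bounded_linear.has_derivative[OF bounded_linear_qcnj] has_derivative_ident
        bounded_linear.has_derivative[OF bounded_bilinear.bounded_linear_left[OF bounded_bilinear_qmult]])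
  then show ?thesis by (simp add: hopf_def[abs_def])
qed

lemma hopf_push:
  "hopf_push x v = qmult (qmult x (\<i>, 0)) (qcnj v) + qmult (qmult v (\<i>, 0)) (qcnj x)"
  unfolding hopf_push_def frechet_derivative_at[OF has_derivative_hopf, symmetric] ..

text \<open>Left translation by \<open>x\<close> trivialises the tangent bundle: a tangent vector at \<open>x\<close> is
  \<open>x (\<i> a + j h)\<close> with \<open>a\<close> real, where \<open>x \<i>\<close> spans the vertical direction.\<close>

definition vert :: "(quat \<Rightarrow> quat) \<Rightarrow> quat \<Rightarrow> real" where
  "vert V x = Im (fst (qmult (qcnj x) (V x)))"

definition horiz :: "(quat \<Rightarrow> quat) \<Rightarrow> quat \<Rightarrow> complex" where
  "horiz V x = snd (qmult (qcnj x) (V x))"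

definition frame_field :: "(quat \<Rightarrow> real) \<Rightarrow> (quat \<Rightarrow> complex) \<Rightarrow> quat \<Rightarrow> quat" where
  "frame_field f h x = (if x \<in> S3 then qmult x (\<i> * of_real (f x), h x) else 0)"

text \<open>The real part of \<open>qmult (qcnj x) (V x)\<close> is the inner product of
  \<open>V x\<close> with \<open>x\<close>, because left translation is isometric; tangency kills
  it.\<close>

lemma frame_decomposition:
  assumes "x \<in> S3" "V x \<bullet> x = 0"
  shows "V x = qmult x (\<i> * of_real (vert V x), horiz V x)"
proof -
  let ?c = "qmult (qcnj x) (V x)"
  have V: "V x = qmult x ?c"
    by (simp add: qcnj_S3 assms flip: qmult_assoc)
  have "?c \<bullet> (1, 0) = qmult x ?c \<bullet> qmult x (1, 0)"
    by (rule inner_qmult(1)[OF assms(1), symmetric])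
  also have "\<dots> = V x \<bullet> x" by (metis V qmult_1(1))
  finally have "Re (fst ?c) = 0"
    using assms by (simp add: inner_prod_def inner_complex_def)
  then have "?c = (\<i> * of_real (vert V x), horiz V x)"
    by (auto simp: prod_eq_iff complex_eq_iff vert_def horiz_def)
  then show ?thesis using V by metis
qed

lemma frame_field_VF: "V \<in> VF_S3 \<Longrightarrow> V = frame_field (vert V) (horiz V)"
  using frame_decomposition by (fastforce simp: VF_S3_def frame_field_def)

lemma vert_frame_field [simp]: "x \<in> S3 \<Longrightarrow> vert (frame_field f h) x = f x"
  and horiz_frame_field [simp]: "x \<in> S3 \<Longrightarrow> horiz (frame_field f h) x = h x"
  by (simp_all add: vert_def horiz_def frame_field_def qcnj_S3 flip: qmult_assoc)

lemmas smooth_on_qmult = smooth_on_bilinear[OF bounded_bilinear_qmult]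
lemmas smooth_on_qcnj = smooth_on_linear[OF bounded_linear_qcnj]

lemma frame_field_in_VF:
  assumes "smooth_on S3 f" "smooth_on S3 h"
  shows "frame_field f h \<in> VF_S3"
proof -
  have "smooth_on S3 (\<lambda>x. qmult x (\<i> * of_real (f x), h x))"
    by (intro smooth_on_qmult smooth_on_ident smooth_on_Pair smooth_on_mult smooth_on_const
        smooth_on_of_real assms)
  then have "smooth_on S3 (frame_field f h)"
    by (rule smooth_on_cong) (simp add: frame_field_def)
  moreover have "frame_field f h x \<bullet> x = 0" if "x \<in> S3" for x
    using inner_qmult(1)[OF that, of "(\<i> * of_real (f x), h x)" "(1, 0)"] that
    by (simp add: frame_field_def inner_prod_def inner_complex_def)
  ultimately show ?thesis
    by (auto simp: VF_S3_def frame_field_def)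
qed

lemma smooth_on_vert: "V \<in> VF_S3 \<Longrightarrow> smooth_on S3 (vert V)"
  and smooth_on_horiz: "V \<in> VF_S3 \<Longrightarrow> smooth_on S3 (horiz V)"
  unfolding vert_def[abs_def] horiz_def[abs_def] VF_S3_def
  by (intro smooth_on_Im smooth_on_fst smooth_on_snd smooth_on_qmult smooth_on_qcnj smooth_on_ident;
      simp)+

lemma inner_frame_field:
  assumes "x \<in> S3"
  shows "frame_field f h x \<bullet> frame_field f' h' x = f x * f' x + h x \<bullet> h' x"
  using inner_qmult(1)[OF assms, of "(\<i> * of_real (f x), h x)" "(\<i> * of_real (f' x), h' x)"] assms
  by (simp add: frame_field_def inner_prod_def inner_complex_def)

text \<open>With \<open>x\<close> pulled out on the left and its conjugate on the right, an
  imaginary u leaves the commutator u i - i u. The vertical component commutes with i and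
  disappears, while the two contributions of the j component add up.\<close>

lemma hopf_push_frame:
  assumes "x \<in> S3"
  shows "hopf_push x (qmult x (\<i> * of_real a, h)) = qmult (qmult x (0, 2 * \<i> * h)) (qcnj x)"
proof -
  have "hopf_push x (qmult x u) =
      qmult (qmult x (qmult (\<i>, 0) (qcnj u) + qmult u (\<i>, 0))) (qcnj x)" for u
    by (simp add: hopf_push qcnj_qmult qmult_assoc qmult_simps)
  moreover have "qmult (\<i>, 0) (qcnj (\<i> * of_real a, h)) + qmult (\<i> * of_real a, h) (\<i>, 0) = (0, 2 * \<i> * h)"
    by (simp add: qmult_def qcnj_def complex_eq_iff)
  ultimately show ?thesis by presburger
qed

lemma hopf_push_horiz:
  assumes "V \<in> VF_S3" "x \<in> S3"
  shows "hopf_push x (V x) = qmult (qmult x (0, 2 * \<i> * horiz V x)) (qcnj x)"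
proof -
  have "V x = qmult x (\<i> * of_real (vert V x), horiz V x)"
    using assms by (intro frame_decomposition) (auto simp: VF_S3_def)
  then show ?thesis using hopf_push_frame[OF assms(2)] by metis
qed

text \<open>The horizontal coefficient turns twice as fast as the fibre parameter because
  \<open>cis t j = j cis (- t)\<close>.\<close>

lemma hopf_push_hopf_circle:
  assumes "V \<in> VF_S3" "x \<in> S3"
  shows "hopf_push (hopf_circle x t) (V (hopf_circle x t)) =
    qmult (qmult x (0, 2 * \<i> * (cis (- 2 * t) * horiz V (hopf_circle x t)))) (qcnj x)"
proof -
  have "qmult (qmult (cis t, 0) (0, 2 * \<i> * w)) (qcnj (cis t, 0)) = (0, 2 * \<i> * (cis (- 2 * t) * w))" for w
  proof -
    have "cis (- t) * cis (- t) = cis (- 2 * t)"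
      by (simp add: cis_mult)
    then show ?thesis
      by (simp add: qmult_def qcnj_def cis_cnj mult.assoc mult.left_commute)
  qed
  moreover have "hopf_push (hopf_circle x t) (V (hopf_circle x t)) =
    qmult (qmult (hopf_circle x t) (0, 2 * \<i> * horiz V (hopf_circle x t))) (qcnj (hopf_circle x t))"
    using assms by (intro hopf_push_horiz hopf_circle_S3)
  ultimately show ?thesis
    by (simp add: hopf_circle_def qcnj_qmult) (metis qmult_assoc)
qed

lemma qmult_left_cancel: "x \<in> S3 \<Longrightarrow> qmult x a = qmult x b \<longleftrightarrow> a = b"
  by (metis qcnj_S3(2) qmult_1(2) qmult_assoc)

lemma conjugation_cancel: "x \<in> S3 \<Longrightarrow> qmult (qmult x a) (qcnj x) = qmult (qmult x b) (qcnj x) \<longleftrightarrow> a = b"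
  by (metis qcnj_S3(2) qmult_1(1) qmult_assoc qmult_left_cancel)


section \<open>Projectable and balanced fields in the frame\<close>

lemma smooth_on_locally:
  assumes "\<And>x. x \<in> M \<Longrightarrow> \<exists>U. open U \<and> x \<in> U \<and> smooth_on (U \<inter> M) f"
  shows "smooth_on M f"
proof (rule smooth_onI)
  fix x assume x: "x \<in> M"
  then obtain U where U: "open U" "x \<in> U" "smooth_on (U \<inter> M) f"
    using assms by meson
  obtain W g where W: "open W" "x \<in> W" "smooth_on W g" "\<And>y. y \<in> W \<inter> (U \<inter> M) \<Longrightarrow> g y = f y"
    using smooth_onE[OF U(3), of x] U x by auto
  have "smooth_on (W \<inter> U) g" by (rule smooth_on_subset[OF W(3)]) auto
  then show "\<exists>U g. open U \<and> x \<in> U \<and> smooth_on U g \<and> (\<forall>y\<in>U \<inter> M. g y = f y)"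
    using U W by (intro exI[of _ "W \<inter> U"] exI[of _ g]) auto
qed

section \<open>Local sections of the Hopf map and descent to the 2-sphere\<close>

lemma S2_coords:
  assumes "y \<in> S2"
  shows "fst y = \<i> * of_real (Im (fst y))" "(Im (fst y))\<^sup>2 + (cmod (snd y))\<^sup>2 = 1"
proof -
  have "Re (fst y) = 0" "(cmod (fst y))\<^sup>2 + (cmod (snd y))\<^sup>2 = 1"
    using assms by (auto simp: S2_def norm_prod_def)
  then show "fst y = \<i> * of_real (Im (fst y))" "(Im (fst y))\<^sup>2 + (cmod (snd y))\<^sup>2 = 1"
    by (auto simp: complex_eq_iff cmod_power2)
qed

text \<open>A section of \<open>hopf\<close> with positive real first coordinate r. For a preimage
  (r, w) of (i a, b) in \<open>S3\<close>, r^2 - |w|^2 = a and r^2 + |w|^2 = 1 give r^2 = (1 + a) /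
  2, and 2 i r w = b gives w. On the 2-sphere it breaks down only at a = -1;
  \<open>section_south\<close> makes the second coordinate positive instead.\<close>

definition section_north :: "quat \<Rightarrow> quat" where
  "section_north y = (let r = sqrt ((1 + Im (fst y)) / 2)
     in (of_real r, of_real (inverse r) * (- \<i> / 2 * snd y)))"

definition section_south :: "quat \<Rightarrow> quat" where
  "section_south y = (let r = sqrt ((1 - Im (fst y)) / 2)
     in (cnj (of_real (inverse r) * (- \<i> / 2 * snd y)), of_real r))"

text \<open>The computation common to both sections; the southern one uses it with \<open>a\<close>
  replaced by its negative.\<close>

lemma section_aux:
  fixes a r :: real and b :: complex
  assumes r: "r > 0" "r\<^sup>2 = (1 + a) / 2" and ab: "a\<^sup>2 + (cmod b)\<^sup>2 = 1"
  defines "u \<equiv> of_real (inverse r) * (- \<i> / 2 * b)"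
  shows "(cmod u)\<^sup>2 = (1 - a) / 2" "2 * \<i> * (of_real r * u) = b"
proof -
  have "(cmod u)\<^sup>2 = inverse (r\<^sup>2) * ((cmod b)\<^sup>2 / 4)"
    by (simp add: u_def norm_mult power_mult_distrib norm_divide norm_inverse power_inverse power_divide)
  also have "\<dots> = inverse ((1 + a) / 2) * ((1 - a) * (1 + a) / 4)"
  proof -
    have "(cmod b)\<^sup>2 = (1 - a) * (1 + a)"
      using ab by (simp add: algebra_simps power2_eq_square)
    then show ?thesis by (simp only: r(2))
  qed
  also have "\<dots> = (1 - a) / 2"
  proof -
    have "1 + a \<noteq> 0" using r by auto
    then show ?thesis by (simp add: field_simps)
  qed
  finally show "(cmod u)\<^sup>2 = (1 - a) / 2" .
  show "2 * \<i> * (of_real r * u) = b"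
    using r(1) by (simp add: u_def field_simps)
qed

lemma section_north:
  assumes y: "y \<in> S2" and a: "Im (fst y) > -1"
  shows "section_north y \<in> S3" "hopf (section_north y) = y"
proof -
  define r where "r = sqrt ((1 + Im (fst y)) / 2)"
  define u where "u = of_real (inverse r) * (- \<i> / 2 * snd y)"
  have r: "r > 0" "r\<^sup>2 = (1 + Im (fst y)) / 2"
    using a by (auto simp: r_def)
  note u = section_aux[OF r S2_coords(2)[OF y], folded u_def]
  have s: "section_north y = (of_real r, u)"
    by (simp add: section_north_def Let_def r_def u_def)
  show "section_north y \<in> S3"
    using r(2) u(1) by (simp add: s norm_S3 norm_prod_def add_divide_distrib[symmetric])
  have "of_real r * cnj (of_real r) - u * cnj u = complex_of_real (Im (fst y))"
  proof -
    have "of_real r * cnj (of_real r) - u * cnj u = complex_of_real (r\<^sup>2 - (cmod u)\<^sup>2)"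
      by (simp only: complex_norm_square of_real_diff) (simp add: power2_eq_square)
    then show ?thesis using r(2) u(1) by (simp add: field_simps)
  qed
  then show "hopf (section_north y) = y"
    using u(2) S2_coords(1)[OF y] by (simp add: s hopf_coords prod_eq_iff)
qed

lemma section_south:
  assumes y: "y \<in> S2" and a: "Im (fst y) < 1"
  shows "section_south y \<in> S3" "hopf (section_south y) = y"
proof -
  define r where "r = sqrt ((1 - Im (fst y)) / 2)"
  define u where "u = of_real (inverse r) * (- \<i> / 2 * snd y)"
  have r: "r > 0" "r\<^sup>2 = (1 + - Im (fst y)) / 2"
    using a by (auto simp: r_def)
  have "(- Im (fst y))\<^sup>2 + (cmod (snd y))\<^sup>2 = 1" using S2_coords(2)[OF y] by simp
  note u = section_aux[OF r this, folded u_def]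
  have s: "section_south y = (cnj u, of_real r)"
    by (simp add: section_south_def Let_def r_def u_def)
  show "section_south y \<in> S3"
    using r(2) u(1) by (simp add: s norm_S3 norm_prod_def add_divide_distrib[symmetric])
  have "cnj u * cnj (cnj u) - of_real r * cnj (of_real r) = complex_of_real (Im (fst y))"
  proof -
    have "cnj u * cnj (cnj u) - of_real r * cnj (of_real r) = complex_of_real ((cmod u)\<^sup>2 - r\<^sup>2)"
      by (simp only: complex_norm_square of_real_diff) (simp add: power2_eq_square mult.commute)
    then show ?thesis using r(2) u(1) by (simp add: field_simps)
  qed
  then show "hopf (section_south y) = y"
    using u(2) S2_coords(1)[OF y] by (simp add: s hopf_coords prod_eq_iff mult.commute)
qed

lemma smooth_on_section_north: "smooth_on {y. Im (fst y) > -1} section_north"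
  unfolding section_north_def[abs_def] Let_def divide_inverse
  by (intro smooth_on_Pair smooth_on_of_real smooth_on_mult smooth_on_inverse smooth_on_sqrt
      smooth_on_add smooth_on_const smooth_on_Im smooth_on_fst smooth_on_snd smooth_on_ident) auto

lemma smooth_on_section_south: "smooth_on {y. Im (fst y) < 1} section_south"
  unfolding section_south_def[abs_def] Let_def divide_inverse
  by (intro smooth_on_Pair smooth_on_of_real smooth_on_mult smooth_on_inverse smooth_on_sqrt
      smooth_on_diff smooth_on_const smooth_on_Im smooth_on_fst smooth_on_snd smooth_on_ident
      smooth_on_cnj) auto

lemma S2_cases: "y \<in> S2 \<Longrightarrow> Im (fst y) > -1 \<or> Im (fst y) < 1"
  by auto

lemma hopf_surj: "y \<in> S2 \<Longrightarrow> \<exists>x\<in>S3. hopf x = y"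
  using section_north section_south S2_cases by metis

text \<open>Locally the descended map is \<open>G\<close> composed with a smooth section, and the
  domains of the two sections cover the 2-sphere. Invariance makes the arbitrary choice of preimage
  in \<open>Y\<close> harmless.\<close>

lemma smooth_descent:
  fixes G :: "quat \<Rightarrow> 'a::real_normed_vector"
  assumes G: "smooth_on S3 G" and inv: "\<And>x t. x \<in> S3 \<Longrightarrow> G (hopf_circle x t) = G x"
  shows "\<exists>Y. smooth_on S2 Y \<and> (\<forall>x\<in>S3. Y (hopf x) = G x)"
proof -
  define Y where "Y y = G (SOME x. x \<in> S3 \<and> hopf x = y)" for y
  have Y: "Y (hopf x) = G x" if x: "x \<in> S3" for x
  proof -
    let ?x = "SOME x'. x' \<in> S3 \<and> hopf x' = hopf x"
    have "?x \<in> S3 \<and> hopf ?x = hopf x"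
      by (rule someI[of _ x]) (use x in simp)
    then obtain t where "?x = hopf_circle x t"
      using hopf_eq_iff[OF x] by blast
    then show ?thesis using inv[OF x] by (simp add: Y_def)
  qed
  have descend: "smooth_on (U \<inter> S2) Y"
    if "smooth_on U s" "\<And>y. y \<in> U \<inter> S2 \<Longrightarrow> s y \<in> S3 \<and> hopf (s y) = y" for U s
  proof (rule smooth_on_cong)
    show "smooth_on (U \<inter> S2) (\<lambda>y. G (s y))"
      by (rule smooth_on_compose[OF G smooth_on_subset[OF that(1)]]) (use that(2) in auto)
    show "G (s y) = Y y" if "y \<in> U \<inter> S2" for y
      using Y \<open>\<And>y. y \<in> U \<inter> S2 \<Longrightarrow> s y \<in> S3 \<and> hopf (s y) = y\<close>[OF that] by metis
  qed
  have "smooth_on S2 Y"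
  proof (rule smooth_on_locally)
    fix y assume y: "y \<in> S2"
    have cont: "continuous_on UNIV (\<lambda>y::quat. Im (fst y))"
      by (intro continuous_intros)
    have "open {y::quat. Im (fst y) > -1}" "open {y::quat. Im (fst y) < 1}"
      by (intro open_Collect_less cont continuous_on_const)+
    then show "\<exists>U. open U \<and> y \<in> U \<and> smooth_on (U \<inter> S2) Y"
      using S2_cases[OF y] descend[OF smooth_on_section_north] descend[OF smooth_on_section_south]
        section_north section_south by blast
  qed
  then show ?thesis using Y by blast
qed

text \<open>Invariance along fibres suffices, since smoothness of the projected field comes from
  \<open>smooth_descent\<close> and tangency from the frame formula.\<close>

lemma PVF_I:
  assumes V: "V \<in> VF_S3"
    and inv: "\<And>x t. x \<in> S3 \<Longrightarrow> hopf_push (hopf_circle x t) (V (hopf_circle x t)) = hopf_push x (V x)"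
  shows "V \<in> PVF"
proof -
  have "smooth_on S3 (\<lambda>x. hopf_push x (V x))"
    unfolding hopf_push using V[unfolded VF_S3_def]
    by (intro smooth_on_add smooth_on_qmult smooth_on_qcnj smooth_on_ident smooth_on_const) auto
  from smooth_descent[OF this inv]
  obtain Y where Y: "smooth_on S2 Y" "\<forall>x\<in>S3. Y (hopf x) = hopf_push x (V x)"
    by blast
  define Y' where "Y' y = (if y \<in> S2 then Y y else 0)" for y
  have "smooth_on S2 Y'"
    by (rule smooth_on_cong[OF Y(1)]) (simp add: Y'_def)
  moreover have "Re (fst (Y' y)) = 0 \<and> Y' y \<bullet> y = 0" if y: "y \<in> S2" for y
  proof -
    obtain x where x: "x \<in> S3" "hopf x = y" using hopf_surj[OF y] by blast
    have Y'y: "Y' y = qmult (qmult x (0, 2 * \<i> * horiz V x)) (qcnj x)"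
      using Y(2) x y hopf_push_horiz[OF V x(1)] by (auto simp: Y'_def)
    \<comment> \<open>Both \<open>hopf x\<close> and the push-forward are conjugates by
      \<open>x\<close>, of i and of an element of the j plane; conjugation by a unit quaternion is
      isometric, so orthogonality can be read off before conjugating.\<close>
    have "qcnj x \<in> S3"
      using x(1) by (simp add: norm_S3 qcnj_def norm_prod_def)
    then have "Y' y \<bullet> y = (0, 2 * \<i> * horiz V x) \<bullet> (\<i>, 0)"
      unfolding Y'y using x(1) by (simp add: x(2)[symmetric] hopf_def inner_qmult)
    then show ?thesis
      by (simp add: Y'y inner_prod_def qmult_def qcnj_def algebra_simps)
  qed
  moreover have "Y' y = 0" if "y \<notin> S2" for y using that by (simp add: Y'_def)
  ultimately have "Y' \<in> VF_S2" by (simp add: VF_S2_def)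
  moreover have "\<forall>x\<in>S3. hopf_push x (V x) = Y' (hopf x)"
    using Y(2) hopf_in_S2 by (simp add: Y'_def)
  ultimately show ?thesis using V by (auto simp: PVF_def)
qed

lemma PVF_iff:
  "V \<in> PVF \<longleftrightarrow> V \<in> VF_S3 \<and> (\<forall>x\<in>S3. \<forall>t. horiz V (hopf_circle x t) = cis (2 * t) * horiz V x)"
proof -
  have push: "hopf_push (hopf_circle x t) (V (hopf_circle x t)) = hopf_push x (V x) \<longleftrightarrow>
      horiz V (hopf_circle x t) = cis (2 * t) * horiz V x" if "V \<in> VF_S3" "x \<in> S3" for x t
  proof -
    have "hopf_push (hopf_circle x t) (V (hopf_circle x t)) = hopf_push x (V x) \<longleftrightarrow>
      cis (- 2 * t) * horiz V (hopf_circle x t) = horiz V x"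
      unfolding hopf_push_hopf_circle[OF that] hopf_push_horiz[OF that] conjugation_cancel[OF that(2)]
      by simp
    also have "\<dots> \<longleftrightarrow> cis (2 * t) * (cis (- 2 * t) * horiz V (hopf_circle x t)) = cis (2 * t) * horiz V x"
      by simp
    also have "\<dots> \<longleftrightarrow> horiz V (hopf_circle x t) = cis (2 * t) * horiz V x"
      by (simp add: cis_mult flip: mult.assoc)
    finally show ?thesis .
  qed
  show ?thesis
  proof
    assume V: "V \<in> PVF"
    then obtain Y where VF: "V \<in> VF_S3" and "\<forall>x\<in>S3. hopf_push x (V x) = Y (hopf x)"
      by (auto simp: PVF_def)
    then have "hopf_push (hopf_circle x t) (V (hopf_circle x t)) = hopf_push x (V x)" if "x \<in> S3" for x t
      using hopf_circle_S3[OF that] hopf_hopf_circle[OF that] that by auto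
    then show "V \<in> VF_S3 \<and> (\<forall>x\<in>S3. \<forall>t. horiz V (hopf_circle x t) = cis (2 * t) * horiz V x)"
      using push[OF VF] VF by blast
  next
    assume "V \<in> VF_S3 \<and> (\<forall>x\<in>S3. \<forall>t. horiz V (hopf_circle x t) = cis (2 * t) * horiz V x)"
    then show "V \<in> PVF" using push by (intro PVF_I) auto
  qed
qed

lemma vector_derivative_hopf_circle: "vector_derivative (hopf_circle x) (at 0) = qmult x (\<i>, 0)"
proof (rule vector_derivative_at)
  have "((\<lambda>t. (cis t, 0::complex)) has_vector_derivative (\<i>, 0)) (at 0)"
    unfolding has_vector_derivative_def by (auto intro!: derivative_eq_intros simp: scaleR_conv_of_real)
  from bounded_linear.has_vector_derivative[OF
      bounded_bilinear.bounded_linear_right[OF bounded_bilinear_qmult] this]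
  show "(hopf_circle x has_vector_derivative qmult x (\<i>, 0)) (at 0)"
    by (simp add: hopf_circle_def[abs_def])
qed

lemma BVF_iff:
  "V \<in> BVF \<longleftrightarrow> V \<in> VF_S3 \<and> (\<forall>x\<in>S3. vert V x = 0 \<and>
     ((\<lambda>t. cis (- 2 * t) * horiz V (hopf_circle x t)) has_integral 0) {0..2*pi})"
proof -
  have h: "V x \<bullet> qmult x (\<i>, 0) = vert V x" if "V \<in> VF_S3" "x \<in> S3" for x
  proof -
    have "V x = qmult x (\<i> * of_real (vert V x), horiz V x)"
      using that by (intro frame_decomposition) (auto simp: VF_S3_def)
    then have "V x \<bullet> qmult x (\<i>, 0) = (\<i> * of_real (vert V x), horiz V x) \<bullet> (\<i>, 0)"
      using inner_qmult(1)[OF that(2)] by metis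
    then show ?thesis by (simp add: inner_prod_def inner_complex_def)
  qed
  have b: "((\<lambda>t. hopf_push (hopf_circle x t) (V (hopf_circle x t))) has_integral 0) {0..2*pi} \<longleftrightarrow>
      ((\<lambda>t. cis (- 2 * t) * horiz V (hopf_circle x t)) has_integral 0) {0..2*pi}"
    if V: "V \<in> VF_S3" and x: "x \<in> S3" for x
  proof -
    \<comment> \<open>Push-forward along one circle is the fixed linear map \<open>T\<close> applied
      to the rotated coefficient. Its left inverse \<open>T'\<close> lets the vanishing of the
      integral be transferred in both directions.\<close>
    define T where "T g = qmult (qmult x (0, 2 * \<i> * g)) (qcnj x)" for g
    define T' where "T' u = - \<i> / 2 * snd (qmult (qmult (qcnj x) u) x)" for u
    have T: "bounded_linear T"
      unfolding T_def[abs_def]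
      by (intro bounded_linear_compose[OF bounded_bilinear.bounded_linear_left[OF bounded_bilinear_qmult]]
          bounded_linear_compose[OF bounded_bilinear.bounded_linear_right[OF bounded_bilinear_qmult]]
          bounded_linear_Pair bounded_linear_zero bounded_linear_mult_right)
    have T': "bounded_linear T'"
      unfolding T'_def[abs_def]
      by (intro bounded_linear_compose[OF bounded_bilinear.bounded_linear_left[OF bounded_bilinear_qmult]]
          bounded_linear_compose[OF bounded_linear_mult_right] bounded_linear_compose[OF bounded_linear_snd]
          bounded_bilinear.bounded_linear_right[OF bounded_bilinear_qmult])
    have "qmult (qmult (qcnj x) (T g)) x = (0, 2 * \<i> * g)" for g
      using qcnj_S3[OF x] unfolding T_def by (metis qmult_1 qmult_assoc)
    then have T'T: "T' (T g) = g" for g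
      by (simp add: T'_def)
    have push: "(\<lambda>t. hopf_push (hopf_circle x t) (V (hopf_circle x t))) =
        T \<circ> (\<lambda>t. cis (- 2 * t) * horiz V (hopf_circle x t))"
      by (rule ext) (simp only: hopf_push_hopf_circle[OF V x] T_def o_def)
    show ?thesis
      unfolding push
    proof
      assume "((T \<circ> (\<lambda>t. cis (- 2 * t) * horiz V (hopf_circle x t))) has_integral 0) {0..2 * pi}"
      from has_integral_linear[OF this T']
      show "((\<lambda>t. cis (- 2 * t) * horiz V (hopf_circle x t)) has_integral 0) {0..2 * pi}"
        by (simp add: o_def T'T linear_0[OF bounded_linear.linear[OF T']])
    next
      assume "((\<lambda>t. cis (- 2 * t) * horiz V (hopf_circle x t)) has_integral 0) {0..2 * pi}"
      from has_integral_linear[OF this T]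
      show "((T \<circ> (\<lambda>t. cis (- 2 * t) * horiz V (hopf_circle x t))) has_integral 0) {0..2 * pi}"
        by (simp add: linear_0[OF bounded_linear.linear[OF T]])
    qed
  qed
  show ?thesis
    unfolding BVF_def balanced_def horizontal_def vector_derivative_hopf_circle
    using h b by auto
qed

section \<open>Averages over Hopf circles\<close>

lemma integral_periodic_shift:
  fixes g :: "real \<Rightarrow> 'a::euclidean_space"
  assumes g: "continuous_on UNIV g" and per: "\<And>t. g (t + p) = g t" and p: "p \<ge> 0"
  shows "integral {0..p} (\<lambda>t. g (s + t)) = integral {0..p} g"
proof -
  have int: "f integrable_on {a..b}" if "continuous_on UNIV f" for f :: "real \<Rightarrow> 'a" and a b
    by (rule integrable_continuous_interval[OF continuous_on_subset[OF that]]) auto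
  have shift: "integral {0..b} (\<lambda>t. f (s + t)) = integral {s..s + b} f"
    if "continuous_on UNIV f" for f :: "real \<Rightarrow> 'a" and s b
  proof -
    have "integral {0..b} (f \<circ> (\<lambda>t. t + s)) = integral {0 + s..b + s} f"
      by (rule integral_shift) (rule continuous_on_subset[OF that], simp)
    then show ?thesis by (simp add: o_def add.commute)
  qed
  have nonneg: "integral {0..p} (\<lambda>t. f (s + t)) = integral {0..p} f"
    if f: "continuous_on UNIV f" "\<And>t. f (t + p) = f t" and s: "s \<ge> 0" for f :: "real \<Rightarrow> 'a" and s
  proof -
    have "integral {0..s} f + integral {s..s + p} f = integral {0..s + p} f"
      by (rule Henstock_Kurzweil_Integration.integral_combine) (use s p int[OF f(1)] in auto)
    moreover have "integral {0..p} f + integral {p..s + p} f = integral {0..s + p} f"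
      by (rule Henstock_Kurzweil_Integration.integral_combine) (use s p int[OF f(1)] in auto)
    moreover have "integral {p..s + p} f = integral {0..s} f"
      using shift[OF f(1), of s p] f(2) by (simp add: add.commute)
    ultimately have "integral {s..s + p} f = integral {0..p} f"
      by (metis add.commute add_left_cancel)
    then show ?thesis using shift[OF f(1), of p s] by simp
  qed
  show ?thesis
  proof (cases "s \<ge> 0")
    case True
    then show ?thesis using nonneg g per by blast
  next
    case False
    \<comment> \<open>A negative shift is undone by a positive one: the previous case is applied to
      the shifted function with shift \<open>- s\<close>.\<close>
    have "continuous_on UNIV (\<lambda>t. g (s + t))"
      by (intro continuous_on_compose2[OF g] continuous_intros) auto
    from nonneg[OF this, of "- s"] per[of "s + _"] False show ?thesis
      by (simp add: add.assoc)
  qed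
qed

text \<open>The Fourier coefficient of weight 2 of \<open>h\<close> along the circle through
  \<open>x\<close>; the normalisation by \<open>2 * pi\<close> makes averaging the identity on
  functions that already have this weight.\<close>

definition fiber_average :: "(quat \<Rightarrow> complex) \<Rightarrow> quat \<Rightarrow> complex" where
  "fiber_average h x = integral {0..2*pi} (\<lambda>t. cis (- 2 * t) * h (hopf_circle x t)) /\<^sub>R (2 * pi)"

lemma smooth_on_hopf_circle:
  assumes "smooth_on M f" "smooth_on M g"
  shows "smooth_on M (\<lambda>x. hopf_circle (f x) (g x))"
  unfolding hopf_circle_def
  by (intro smooth_on_qmult smooth_on_Pair smooth_on_cis smooth_on_const assms)

lemma sgn_S3: "x \<noteq> 0 \<Longrightarrow> sgn x \<in> S3"
  by (simp add: norm_S3 norm_sgn)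

lemma sgn_S3_ident: "x \<in> S3 \<Longrightarrow> sgn x = x"
  by (simp add: norm_S3 sgn_div_norm)

text \<open>Differentiation under the integral requires an open parameter domain, so
  \<open>x\<close> is first replaced by \<open>sgn x\<close>, which extends the average to a
  function constant on rays off the origin.\<close>

lemma smooth_on_fiber_average:
  assumes h: "smooth_on S3 h"
  shows "smooth_on S3 (fiber_average h)"
proof -
  have "smooth_on ((- {0}) \<times> UNIV) (\<lambda>z. cis (- 2 * snd z) * h (hopf_circle (sgn (fst z)) (snd z)))"
    by (intro smooth_on_mult smooth_on_cis smooth_on_const smooth_on_snd smooth_on_ident
        smooth_on_compose[OF h] smooth_on_hopf_circle smooth_on_sgn smooth_on_fst)
      (use hopf_circle_S3 sgn_S3 in fastforce)+
  then have "smooth_on (- {0}) (\<lambda>x. integral {0..2*pi} (\<lambda>t. cis (- 2 * t) * h (hopf_circle (sgn x) t)))"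
    by (intro smooth_on_integral open_Compl closed_singleton) (simp add: case_prod_beta')
  then have "smooth_on (- {0}) (\<lambda>x. fiber_average h (sgn x))"
    unfolding fiber_average_def by (intro smooth_on_scaleR smooth_on_const)
  then have "smooth_on S3 (\<lambda>x. fiber_average h (sgn x))"
    by (rule smooth_on_subset) (auto dest: S3_not_0)
  then show ?thesis
    by (rule smooth_on_cong) (simp add: sgn_S3_ident)
qed

lemma continuous_fiber_integrand:
  assumes h: "smooth_on S3 h" and x: "x \<in> S3"
  shows "continuous_on UNIV (\<lambda>t. cis (- 2 * t) * h (hopf_circle x t))"
  by (rule smooth_on_imp_continuous_on, intro smooth_on_mult smooth_on_cis smooth_on_const smooth_on_ident
      smooth_on_compose[OF h] smooth_on_hopf_circle) (auto simp: hopf_circle_S3 x)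

text \<open>Moving the base point by \<open>s\<close> shifts the integration variable, which an
  integral over a full period does not notice, and leaves the phase in
  \<open>cis (- 2 * t) = cis (2 * s) * cis (- 2 * (s + t))\<close>.\<close>

lemma fiber_average_hopf_circle:
  assumes h: "smooth_on S3 h" and x: "x \<in> S3"
  shows "fiber_average h (hopf_circle x s) = cis (2 * s) * fiber_average h x"
proof -
  let ?g = "\<lambda>t. cis (- 2 * t) * h (hopf_circle x t)"
  have cis_per: "cis (t + 2 * pi) = cis t" for t
    by (metis cis_mult cis_2pi mult_1_right)
  have "cis (- 2 * t) = cis (- 2 * (t + 2 * pi) + 2 * pi + 2 * pi)" for t
    by (simp add: algebra_simps)
  then have per: "?g (t + 2 * pi) = ?g t" for t
    by (simp only: hopf_circle_def cis_per)
  have "integral {0..2*pi} (\<lambda>t. ?g (s + t)) = integral {0..2*pi} ?g"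
    by (rule integral_periodic_shift[OF continuous_fiber_integrand[OF h x] per]) simp
  moreover have "cis (- 2 * t) * h (hopf_circle (hopf_circle x s) t) = cis (2 * s) * ?g (s + t)" for t
    by (simp add: hopf_circle_add cis_mult algebra_simps)
  ultimately show ?thesis
    by (simp add: fiber_average_def)
qed


section \<open>The direct sum decomposition\<close>

lemma VF_S3_add: "V \<in> VF_S3 \<Longrightarrow> W \<in> VF_S3 \<Longrightarrow> V + W \<in> VF_S3"
  by (auto simp: VF_S3_def plus_fun_def inner_add_left intro: smooth_on_add)

lemma VF_S3_scale: "V \<in> VF_S3 \<Longrightarrow> (\<lambda>x. c *\<^sub>R V x) \<in> VF_S3"
  by (auto simp: VF_S3_def intro: smooth_on_scaleR smooth_on_const)

lemma VF_S3_zero: "0 \<in> VF_S3"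
  by (auto simp: VF_S3_def zero_fun_def intro: smooth_on_const)

lemma frame_add: "vert (V + W) x = vert V x + vert W x" "horiz (V + W) x = horiz V x + horiz W x"
  by (simp_all add: vert_def horiz_def qmult_simps)

lemma frame_scale:
  "vert (\<lambda>x. c *\<^sub>R V x) x = c * vert V x" "horiz (\<lambda>x. c *\<^sub>R V x) x = c *\<^sub>R horiz V x"
  by (simp_all add: vert_def horiz_def qmult_simps)

lemma frame_zero [simp]: "vert 0 x = 0" "horiz 0 x = 0"
  by (simp_all add: vert_def horiz_def)

lemma linear_subspaceI:
  assumes "0 \<in> S" "\<And>V W. V \<in> S \<Longrightarrow> W \<in> S \<Longrightarrow> V + W \<in> S"
    "\<And>c V. V \<in> S \<Longrightarrow> (\<lambda>x. c *\<^sub>R V x) \<in> S"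
  shows "linear_subspace S"
proof -
  interpret module "\<lambda>(c::real) V x. c *\<^sub>R (V x :: 'b)"
    by unfold_locales (auto simp: algebra_simps)
  show ?thesis by (rule subspaceI) (use assms in auto)
qed

lemma PVF_subspace: "linear_subspace PVF"
  by (rule linear_subspaceI)
    (auto simp: PVF_iff VF_S3_zero VF_S3_add VF_S3_scale frame_add frame_scale algebra_simps)

lemma BVF_subspace: "linear_subspace BVF"
proof (rule linear_subspaceI)
  show "0 \<in> BVF" by (auto simp: BVF_iff VF_S3_zero)
next
  fix V W assume VW: "V \<in> BVF" "W \<in> BVF"
  have "((\<lambda>t. cis (- 2 * t) * horiz (V + W) (hopf_circle x t)) has_integral 0) {0..2*pi}"
    if "x \<in> S3" for x
  proof -
    have "((\<lambda>t. cis (- 2 * t) * horiz V (hopf_circle x t) + cis (- 2 * t) * horiz W (hopf_circle x t))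
        has_integral 0 + 0) {0..2*pi}"
      by (intro has_integral_add) (use VW that in \<open>auto simp: BVF_iff\<close>)
    then show ?thesis by (simp add: frame_add distrib_left)
  qed
  then show "V + W \<in> BVF"
    using VW by (simp add: BVF_iff VF_S3_add frame_add)
next
  fix c V assume V: "V \<in> BVF"
  have "((\<lambda>t. cis (- 2 * t) * horiz (\<lambda>x. c *\<^sub>R V x) (hopf_circle x t)) has_integral 0) {0..2*pi}"
    if "x \<in> S3" for x
  proof -
    have "((\<lambda>t. c *\<^sub>R (cis (- 2 * t) * horiz V (hopf_circle x t))) has_integral c *\<^sub>R 0) {0..2*pi}"
      by (intro has_integral_cmul) (use V that in \<open>auto simp: BVF_iff\<close>)
    then show ?thesis by (simp add: frame_scale)
  qed
  then show "(\<lambda>x. c *\<^sub>R V x) \<in> BVF"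
    using V by (simp add: BVF_iff VF_S3_scale frame_scale)
qed

text \<open>For a projectable field the integrand is constant in \<open>t\<close>. Hence averaging
  fixes its horizontal coefficient, and a projectable field that is also balanced has no horizontal
  part.\<close>

lemma PVF_fiber_average:
  assumes "V \<in> PVF" "x \<in> S3"
  shows "((\<lambda>t. cis (- 2 * t) * horiz V (hopf_circle x t)) has_integral (2 * pi) *\<^sub>R horiz V x) {0..2*pi}"
proof -
  have "cis (- 2 * t) * horiz V (hopf_circle x t) = horiz V x" for t
    using assms by (simp add: PVF_iff cis_mult flip: mult.assoc)
  then show ?thesis
    using has_integral_const_real[of "horiz V x" 0 "2 * pi"] by simp
qed

lemma PVF_Int_BVF: "PVF \<inter> BVF = {0}"
proof -
  have "V = 0" if V: "V \<in> PVF" "V \<in> BVF" for V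
  proof -
    have "horiz V x = 0" "vert V x = 0" if x: "x \<in> S3" for x
    proof -
      have "((\<lambda>t. cis (- 2 * t) * horiz V (hopf_circle x t)) has_integral 0) {0..2*pi}"
        using V(2) x unfolding BVF_iff by blast
      from has_integral_unique[OF PVF_fiber_average[OF V(1) x] this]
      show "horiz V x = 0" by simp
      show "vert V x = 0" using V(2) x unfolding BVF_iff by blast
    qed
    then have "frame_field (vert V) (horiz V) x = 0" for x
      by (simp add: frame_field_def qmult_def zero_prod_def)
    then show ?thesis
      using V(1) frame_field_VF by (auto simp: PVF_iff fun_eq_iff)
  qed
  moreover have "0 \<in> PVF" "0 \<in> BVF"
    by (auto simp: PVF_iff BVF_iff VF_S3_zero)
  ultimately show ?thesis by blast
qed

definition balanced_part :: "(quat \<Rightarrow> quat) \<Rightarrow> quat \<Rightarrow> quat" where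
  "balanced_part V = frame_field (\<lambda>_. 0) (\<lambda>x. horiz V x - fiber_average (horiz V) x)"

definition projectable_part :: "(quat \<Rightarrow> quat) \<Rightarrow> quat \<Rightarrow> quat" where
  "projectable_part V = frame_field (vert V) (fiber_average (horiz V))"

text \<open>Projectability leaves the vertical coefficient unconstrained while balance forces it to
  vanish, so it goes entirely into the projectable part; only the horizontal coefficient is
  averaged.\<close>

lemma decomposition:
  assumes V: "V \<in> VF_S3"
  shows "projectable_part V \<in> PVF" "balanced_part V \<in> BVF" "projectable_part V + balanced_part V = V"
proof -
  let ?h = "horiz V"
  have h: "smooth_on S3 ?h" by (rule smooth_on_horiz[OF V])
  have P: "projectable_part V \<in> VF_S3"
    unfolding projectable_part_def
    by (intro frame_field_in_VF smooth_on_vert V smooth_on_fiber_average h)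
  have B: "balanced_part V \<in> VF_S3"
    unfolding balanced_part_def
    by (intro frame_field_in_VF smooth_on_const smooth_on_diff smooth_on_fiber_average h)
  show PVF: "projectable_part V \<in> PVF"
    unfolding PVF_iff using P
    by (auto simp: projectable_part_def hopf_circle_S3 fiber_average_hopf_circle[OF h])
  have "((\<lambda>t. cis (- 2 * t) * horiz (balanced_part V) (hopf_circle x t)) has_integral 0) {0..2*pi}"
    if x: "x \<in> S3" for x
  proof -
    have "(\<lambda>t. cis (- 2 * t) * ?h (hopf_circle x t)) integrable_on {0..2*pi}"
      by (rule integrable_continuous_interval[OF continuous_on_subset[OF continuous_fiber_integrand[OF h x]]])
        simp
    then have "((\<lambda>t. cis (- 2 * t) * ?h (hopf_circle x t)) has_integral (2 * pi) *\<^sub>R fiber_average ?h x) {0..2*pi}"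
      by (simp add: fiber_average_def has_integral_integral)
    \<comment> \<open>\<open>V\<close> and its projectable part have the same weighted integral over
      each circle, so their difference has mean zero.\<close>
    from has_integral_diff[OF this PVF_fiber_average[OF PVF x]]
    show ?thesis
      using x by (simp add: projectable_part_def balanced_part_def hopf_circle_S3 algebra_simps)
  qed
  then show "balanced_part V \<in> BVF"
    unfolding BVF_iff using B by (simp add: balanced_part_def)
  have "projectable_part V + balanced_part V = frame_field (vert V) ?h"
    by (auto simp: projectable_part_def balanced_part_def frame_field_def fun_eq_iff simp flip: qmult_simps)
  then show "projectable_part V + balanced_part V = V"
    using frame_field_VF[OF V] by simp
qed

lemma direct_sum_PVF_BVF: "is_direct_sum PVF BVF VF_S3"
  unfolding is_direct_sum_def
proof (intro conjI PVF_subspace BVF_subspace PVF_Int_BVF set_eqI iffI)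
  show "V \<in> VF_S3" if "V \<in> PVF + BVF" for V
    using that by (auto elim!: set_plus_elim intro: VF_S3_add simp: PVF_iff BVF_iff)
  show "V \<in> PVF + BVF" if "V \<in> VF_S3" for V
    using decomposition[OF that] set_plus_intro by metis
qed


section \<open>Rotation invariance of the surface measure\<close>

text \<open>By Vitali's theorem an open set is, up to a null set, a disjoint union of balls, and an
  orthogonal transformation maps balls to balls of the same radius.\<close>

lemma emeasure_le_orthogonal_vimage:
  fixes f :: "'a::euclidean_space \<Rightarrow> 'a"
  assumes f: "orthogonal_transformation f" and S: "open S"
  shows "emeasure lborel S \<le> emeasure lborel (f -` S)"
proof -
  define K where "K = {(x, r). 0 < r \<and> ball x r \<subseteq> S}"
  obtain C where C: "countable C" "C \<subseteq> K"
    "pairwise (\<lambda>i j. disjnt (ball (fst i) (snd i)) (ball (fst j) (snd j))) C"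
    "negligible (S - (\<Union>i\<in>C. ball (fst i) (snd i)))"
  proof (rule Vitali_covering_theorem_balls[of S K fst snd])
    fix x and d :: real assume "x \<in> S" "0 < d"
    then obtain e where "e > 0" "ball x e \<subseteq> S" using S openE by meson
    then show "\<exists>i. i \<in> K \<and> x \<in> ball (fst i) (snd i) \<and> snd i < d"
      using \<open>0 < d\<close> by (intro exI[of _ "(x, min e (d / 2))"]) (auto simp: K_def)
  qed
  have inv: "orthogonal_transformation (inv f)" and bij: "bij f"
    using f by (auto intro: orthogonal_transformation_inv orthogonal_transformation_bij)
  have f_ball: "f -` ball x r = ball (inv f x) r" for x r
    using image_orthogonal_transformation_ball[OF inv] bij_vimage_eq_inv_image[OF bij] by metis
  let ?U = "\<Union>i\<in>C. ball (fst i) (snd i)"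
  have "open ?U" by blast
  have disj: "disjoint_family_on (\<lambda>i. ball (fst i) (snd i)) C"
    using C(3) by (auto simp: disjoint_family_on_def pairwise_def disjnt_def)
  then have disj': "disjoint_family_on (\<lambda>i. f -` ball (fst i) (snd i)) C"
    by (fastforce simp: disjoint_family_on_def)
  have null: "emeasure lborel (S - ?U) = 0"
  proof -
    have "S - ?U \<in> null_sets lebesgue" using C(4) by (simp add: negligible_iff_null_sets)
    moreover have "S - ?U \<in> sets borel" using S \<open>open ?U\<close> by auto
    ultimately show ?thesis by (auto simp: null_sets_def)
  qed
  have "emeasure lborel S \<le> emeasure lborel (?U \<union> (S - ?U))"
    using S \<open>open ?U\<close> by (intro emeasure_mono) auto
  also have "\<dots> \<le> emeasure lborel ?U + emeasure lborel (S - ?U)"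
    using S \<open>open ?U\<close> by (intro emeasure_subadditive) auto
  also have "\<dots> = emeasure lborel ?U"
    by (simp only: null add_0_right)
  also have "\<dots> = (\<integral>\<^sup>+i. emeasure lborel (ball (fst i) (snd i)) \<partial>count_space C)"
    by (rule emeasure_UN_countable[OF _ C(1) disj]) auto
  also have "\<dots> = (\<integral>\<^sup>+i. emeasure lborel (f -` ball (fst i) (snd i)) \<partial>count_space C)"
  proof (rule nn_integral_cong)
    fix i assume "i \<in> space (count_space C)"
    then have "0 \<le> snd i" using C(2) by (auto simp: K_def)
    then show "emeasure lborel (ball (fst i) (snd i)) = emeasure lborel (f -` ball (fst i) (snd i))"
      by (simp add: f_ball emeasure_ball)
  qed
  also have "\<dots> = emeasure lborel (\<Union>i\<in>C. f -` ball (fst i) (snd i))"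
    by (rule emeasure_UN_countable[OF _ C(1) disj', symmetric]) (simp add: f_ball)
  also have "\<dots> \<le> emeasure lborel (f -` S)"
  proof (rule emeasure_mono)
    show "(\<Union>i\<in>C. f -` ball (fst i) (snd i)) \<subseteq> f -` S"
      using C(2) by (force simp: K_def)
    have "continuous_on UNIV f"
      using f by (simp add: linear_continuous_on linear_linear orthogonal_transformation_linear)
    then show "f -` S \<in> sets lborel" using S by (simp add: borel_open open_vimage)
  qed
  finally show ?thesis .
qed

text \<open>The inequality for \<open>f\<close> and for its inverse gives equality on boxes, and
  boxes determine Lebesgue measure.\<close>

lemma lborel_orthogonal_invariant:
  fixes f :: "'a::euclidean_space \<Rightarrow> 'a"
  assumes f: "orthogonal_transformation f"
  shows "distr lborel borel f = lborel"
proof (rule lborel_eqI[symmetric])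
  have inv: "orthogonal_transformation (inv f)" and bij: "bij f"
    using f by (auto intro: orthogonal_transformation_inv orthogonal_transformation_bij)
  have cont: "continuous_on UNIV f"
    using f by (simp add: linear_continuous_on linear_linear orthogonal_transformation_linear)
  then have meas: "f \<in> measurable lborel borel"
    by (simp add: borel_measurable_continuous_onI)
  fix l u :: 'a assume lu: "\<And>b. b \<in> Basis \<Longrightarrow> l \<bullet> b \<le> u \<bullet> b"
  have "emeasure lborel (f -` box l u) \<le> emeasure lborel (inv f -` (f -` box l u))"
    using cont by (intro emeasure_le_orthogonal_vimage[OF inv] open_vimage) auto
  moreover have "inv f -` (f -` box l u) = box l u"
    using bij by (auto simp: bij_is_surj surj_f_inv_f)
  ultimately have "emeasure lborel (f -` box l u) = emeasure lborel (box l u)"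
    using emeasure_le_orthogonal_vimage[OF f open_box, of l u] by (metis antisym)
  then show "emeasure (distr lborel borel f) (box l u) = ennreal (\<Prod>b\<in>Basis. (u - l) \<bullet> b)"
    using lu by (simp add: emeasure_distr[OF meas] emeasure_lborel_box_eq)
qed simp

section \<open>The surface measure of the unit sphere\<close>

lemma sets_sphere_measure [measurable_cong]:
  "sets (sphere_measure :: 'a::euclidean_space measure) = sets (restrict_space borel (sphere 0 1))"
  by (simp add: sphere_measure_def)

lemma space_sphere_measure [simp]: "space (sphere_measure :: 'a::euclidean_space measure) = sphere 0 1"
  using sets_eq_imp_space_eq[OF sets_sphere_measure] by (simp add: space_restrict_space)

lemma emeasure_sphere_measure:
  fixes A :: "'a::euclidean_space set"
  assumes A: "A \<in> sets borel" "A \<subseteq> sphere 0 1"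
  shows "emeasure sphere_measure A = of_nat DIM('a) * emeasure lborel (sgn -` A \<inter> (cball 0 1 - {0}))"
proof -
  let ?M = "restrict_space lborel (cball 0 1 - {0}) :: 'a measure"
  let ?N = "restrict_space borel (sphere 0 1) :: 'a measure"
  have meas: "sgn \<in> measurable ?M ?N"
    by (rule measurable_restrict_space2)
      (auto simp: space_restrict_space norm_sgn intro: measurable_restrict_space1)
  have "A \<in> sets ?N"
    using A by (auto simp: sets_restrict_space_iff)
  then have "emeasure (distr ?M ?N sgn) A = emeasure ?M (sgn -` A \<inter> space ?M)"
    by (rule emeasure_distr[OF meas])
  also have "\<dots> = emeasure lborel (sgn -` A \<inter> (cball 0 1 - {0}))"
    by (simp add: emeasure_restrict_space space_restrict_space)
  finally show ?thesis by (simp add: sphere_measure_def)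
qed

lemma finite_measure_sphere_measure: "finite_measure (sphere_measure :: 'a::euclidean_space measure)"
proof (rule finite_measureI)
  have "emeasure lborel (sgn -` sphere 0 1 \<inter> (cball (0::'a) 1 - {0})) \<le> emeasure lborel (cball (0::'a) 1)"
    by (rule emeasure_mono) auto
  also have "\<dots> < \<infinity>" by (rule emeasure_lborel_cball_finite)
  finally show "emeasure (sphere_measure :: 'a measure) (space sphere_measure) \<noteq> \<infinity>"
    by (simp add: emeasure_sphere_measure ennreal_mult_eq_top_iff)
qed

lemma orthogonal_measurable_sphere:
  fixes f :: "'a::euclidean_space \<Rightarrow> 'a"
  assumes "orthogonal_transformation f"
  shows "f \<in> measurable sphere_measure sphere_measure"
proof -
  have "continuous_on UNIV f"
    using assms by (simp add: linear_continuous_on linear_linear orthogonal_transformation_linear)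
  then have "f \<in> borel_measurable borel" by (rule borel_measurable_continuous_onI)
  then have "f \<in> measurable (restrict_space borel (sphere 0 1)) (restrict_space borel (sphere 0 1))"
    using assms by (intro measurable_restrict_space2 measurable_restrict_space1)
      (auto simp: space_restrict_space orthogonal_transformation_norm)
  then show ?thesis
    by (simp cong: measurable_cong_sets add: sets_sphere_measure)
qed

text \<open>An orthogonal map commutes with \<open>sgn\<close> and preserves the punctured ball, so
  the cone over a preimage is the preimage of the cone. This reduces the claim to Lebesgue
  measure.\<close>

lemma sphere_measure_orthogonal_invariant:
  fixes f :: "'a::euclidean_space \<Rightarrow> 'a"
  assumes f: "orthogonal_transformation f"
  shows "distr sphere_measure sphere_measure f = sphere_measure"
proof (rule measure_eqI)
  fix A assume "A \<in> sets (distr sphere_measure sphere_measure f)"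
  then have A: "A \<in> sets borel" "A \<subseteq> sphere 0 1"
    by (auto simp: sets_sphere_measure sets_restrict_space_iff)
  have meas: "f \<in> borel_measurable borel"
    using f by (intro borel_measurable_continuous_onI)
      (simp add: linear_continuous_on linear_linear orthogonal_transformation_linear)
  have norm: "norm (f x) = norm x" for x
    using f by (rule orthogonal_transformation_norm)
  have f0: "f x = 0 \<longleftrightarrow> x = 0" for x using norm[of x] by (metis norm_eq_zero)
  have sgn: "sgn (f x) = f (sgn x)" for x
    using f by (simp add: sgn_div_norm norm linear_scale orthogonal_transformation_linear)
  let ?B = "sgn -` A \<inter> (cball 0 1 - {0})"
  have B: "?B \<in> sets borel"
    using measurable_sets_borel[OF borel_measurable_sgn A(1)] by auto
  have "emeasure (distr sphere_measure sphere_measure f) A = emeasure sphere_measure (f -` A \<inter> sphere 0 1)"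
    using A by (subst emeasure_distr[OF orthogonal_measurable_sphere[OF f]])
      (auto simp: sets_sphere_measure sets_restrict_space_iff)
  also have "\<dots> = of_nat DIM('a) * emeasure lborel (sgn -` (f -` A \<inter> sphere 0 1) \<inter> (cball 0 1 - {0}))"
    using measurable_sets_borel[OF meas A(1)] by (intro emeasure_sphere_measure) auto
  also have "sgn -` (f -` A \<inter> sphere 0 1) \<inter> (cball 0 1 - {0}) = f -` ?B"
    by (auto simp: norm f0 sgn norm_sgn)
  also have "emeasure lborel (f -` ?B) = emeasure (distr lborel borel f) ?B"
    using meas B by (subst emeasure_distr) auto
  also have "\<dots> = emeasure lborel ?B"
    by (simp only: lborel_orthogonal_invariant[OF f])
  also have "of_nat DIM('a) * \<dots> = emeasure sphere_measure A"
    by (rule emeasure_sphere_measure[OF A, symmetric])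
  finally show "emeasure (distr sphere_measure sphere_measure f) A = emeasure sphere_measure A" .
qed simp

lemma integrable_sphere_measure:
  fixes g :: "'a::euclidean_space \<Rightarrow> real"
  assumes g: "continuous_on (sphere 0 1) g"
  shows "g \<in> borel_measurable sphere_measure" "integrable sphere_measure g"
proof -
  interpret finite_measure "sphere_measure :: 'a measure" by (rule finite_measure_sphere_measure)
  show m: "g \<in> borel_measurable sphere_measure"
    using borel_measurable_continuous_on_restrict[OF g]
    by (simp cong: measurable_cong_sets add: sets_sphere_measure)
  have "bounded (g ` sphere 0 1)"
    by (intro compact_imp_bounded compact_continuous_image g) simp
  then obtain B where "\<forall>x\<in>sphere 0 1. norm (g x) \<le> B" by (auto simp: bounded_iff)
  then show "integrable sphere_measure g"
    by (intro integrable_const_bound[of _ B] m AE_I2) auto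
qed

text \<open>The set where \<open>g\<close> is nonzero is relatively open in the sphere; were it
  nonempty, the cone over it would contain a nonempty open set, contradicting measure zero.\<close>

lemma sphere_integral_zero_imp:
  fixes g :: "'a::euclidean_space \<Rightarrow> real"
  assumes g: "continuous_on (sphere 0 1) g" "\<And>x. x \<in> sphere 0 1 \<Longrightarrow> 0 \<le> g x"
    and zero: "(\<integral>x. g x \<partial>sphere_measure) = 0" and x: "x \<in> sphere 0 1"
  shows "g x = 0"
proof (rule ccontr)
  assume "g x \<noteq> 0"
  obtain W where W: "open W" "W \<inter> sphere 0 1 = g -` (- {0}) \<inter> sphere 0 1"
    using g(1) unfolding continuous_on_open_invariant by (metis closed_singleton open_Compl)
  have AE: "AE x in sphere_measure. g x = 0"
    using integral_nonneg_eq_0_iff_AE[OF integrable_sphere_measure(2)[OF g(1)] AE_I2] g(2) zero by simp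
  have "W \<inter> sphere 0 1 \<in> sets sphere_measure"
    using W(1) by (auto simp: sets_sphere_measure sets_restrict_space_iff)
  moreover have "{x \<in> space sphere_measure. \<not> g x = 0} = W \<inter> sphere 0 1"
    unfolding W(2) by auto
  ultimately have "emeasure sphere_measure (W \<inter> sphere 0 1) = 0"
    using AE AE_iff_measurable[of "W \<inter> sphere 0 1" sphere_measure "\<lambda>x. g x = 0"] by blast
  then have 0: "emeasure lborel (sgn -` (W \<inter> sphere 0 1) \<inter> (cball 0 1 - {0})) = 0"
    using W(1) by (subst (asm) emeasure_sphere_measure) auto
  \<comment> \<open>The open ball makes the cone open but excludes the sphere itself, so the point
    that shows it nonempty is half of \<open>x\<close>.\<close>
  let ?O = "(ball 0 1 - {0}) \<inter> sgn -` W"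
  have "open ?O"
    by (intro continuous_open_preimage W(1)) (auto intro!: continuous_on_sgn continuous_on_id)
  have meas: "sgn -` (W \<inter> sphere 0 1) \<inter> (cball (0::'a) 1 - {0}) \<in> sets borel"
    using measurable_sets_borel[OF borel_measurable_sgn, of "W \<inter> sphere 0 1"] W(1) by auto
  have "emeasure lborel ?O \<le> emeasure lborel (sgn -` (W \<inter> sphere 0 1) \<inter> (cball 0 1 - {0}))"
    using meas by (intro emeasure_mono) (auto simp: norm_sgn)
  then have "emeasure lborel ?O = 0" using 0 by simp
  then have "?O \<in> null_sets lebesgue"
    using \<open>open ?O\<close> by (simp add: null_sets_def)
  then have "negligible ?O" by (simp add: negligible_iff_null_sets)
  then have "?O = {}" using \<open>open ?O\<close> open_not_negligible by blast
  moreover have "(1/2) *\<^sub>R x \<in> ?O"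
    using x W(2) \<open>g x \<noteq> 0\<close> by (auto simp: sgn_div_norm)
  ultimately show False by blast
qed

lemma orthogonal_hopf_circle: "orthogonal_transformation (\<lambda>x. hopf_circle x t)"
  unfolding hopf_circle_def orthogonal_transformation
  by (simp add: norm_qmult norm_Pair bounded_linear.linear[OF
        bounded_bilinear.bounded_linear_left[OF bounded_bilinear_qmult]])

text \<open>Since circle rotations preserve the measure, the integral of
  \<open>p (hopf_circle x t)\<close> over \<open>x\<close> does not depend on \<open>t\<close>.
  Integrating over \<open>t\<close> and exchanging the integrals leaves the fibre integrals, all
  zero.\<close>

lemma fiber_integrals_zero_imp:
  fixes p :: "quat \<Rightarrow> real"
  assumes p: "continuous_on S3 p"
    and zero: "\<And>x. x \<in> S3 \<Longrightarrow> ((\<lambda>t. p (hopf_circle x t)) has_integral 0) {0..2*pi}"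
  shows "(\<integral>x. p x \<partial>sphere_measure) = 0"
proof -
  let ?\<mu> = "sphere_measure :: quat measure" and ?I = "restrict_space lborel {0..2*pi} :: real measure"
  interpret \<mu>: finite_measure ?\<mu> by (rule finite_measure_sphere_measure)
  interpret I: finite_measure ?I
    by (rule finite_measureI) (simp add: emeasure_restrict_space space_restrict_space)
  interpret P: finite_measure "?I \<Otimes>\<^sub>M ?\<mu>"
    by (rule finite_measure_pair_measure) unfold_locales
  interpret pair_sigma_finite ?I ?\<mu> ..
  have p': "continuous_on (sphere 0 1) p" using p by (simp add: S3_def)
  note pm = integrable_sphere_measure[OF p']
  have circ: "(\<lambda>z. hopf_circle (snd z) (fst z)) \<in> measurable (?I \<Otimes>\<^sub>M ?\<mu>) ?\<mu>"
  proof -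
    have "(\<lambda>x. x) \<in> measurable ?\<mu> borel"
      by (simp cong: measurable_cong_sets add: sets_sphere_measure measurable_restrict_space1)
    moreover have "(\<lambda>x. x) \<in> measurable ?I borel"
      by (simp add: measurable_restrict_space1)
    ultimately have "(\<lambda>z. hopf_circle (snd z) (fst z)) \<in> borel_measurable (?I \<Otimes>\<^sub>M ?\<mu>)"
      by (intro borel_measurable_continuous_Pair[of "\<lambda>z. snd z" _ "\<lambda>z. fst z" hopf_circle]
          measurable_compose[OF measurable_snd] measurable_compose[OF measurable_fst]
          smooth_on_imp_continuous_on smooth_on_hopf_circle smooth_on_fst smooth_on_snd smooth_on_ident)
    then have "(\<lambda>z. hopf_circle (snd z) (fst z)) \<in> measurable (?I \<Otimes>\<^sub>M ?\<mu>) (restrict_space borel (sphere 0 1))"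
      by (intro measurable_restrict_space2)
        (auto simp: space_pair_measure hopf_circle_S3[unfolded norm_S3])
    then show ?thesis
      by (simp cong: measurable_cong_sets add: sets_sphere_measure)
  qed
  obtain B where B: "\<forall>x\<in>S3. norm (p x) \<le> B"
  proof -
    have "bounded (p ` S3)"
      by (intro compact_imp_bounded compact_continuous_image p) (simp add: S3_def)
    then show ?thesis using that by (auto simp: bounded_iff)
  qed
  have int: "integrable (?I \<Otimes>\<^sub>M ?\<mu>) (\<lambda>(t, x). p (hopf_circle x t))"
  proof (rule P.integrable_const_bound[of _ B])
    show "(\<lambda>(t, x). p (hopf_circle x t)) \<in> borel_measurable (?I \<Otimes>\<^sub>M ?\<mu>)"
      using measurable_compose[OF circ pm(1)] by (simp add: case_prod_beta')
    show "AE z in ?I \<Otimes>\<^sub>M ?\<mu>. norm (case z of (t, x) \<Rightarrow> p (hopf_circle x t)) \<le> B"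
      using B hopf_circle_S3 by (intro AE_I2) (auto simp: space_pair_measure S3_def)
  qed
  have inner: "(\<integral>t. p (hopf_circle x t) \<partial>?I) = 0" if x: "x \<in> S3" for x
  proof -
    have "continuous_on {0..2*pi} (\<lambda>t. p (hopf_circle x t))"
      by (intro continuous_on_compose2[OF p] smooth_on_imp_continuous_on smooth_on_hopf_circle
          smooth_on_const smooth_on_ident) (auto simp: hopf_circle_S3 x)
    from set_borel_integral_eq_integral(2)[OF borel_integrable_atLeastAtMost'[OF this]]
    show ?thesis
      using integral_unique[OF zero[OF x]] by (simp add: integral_restrict_space set_lebesgue_integral_def)
  qed
  have outer: "(\<integral>x. p (hopf_circle x t) \<partial>?\<mu>) = (\<integral>x. p x \<partial>?\<mu>)" for t
    using integral_distr[OF orthogonal_measurable_sphere[OF orthogonal_hopf_circle] pm(1), of t]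
    by (simp add: sphere_measure_orthogonal_invariant orthogonal_hopf_circle)
  have "(\<integral>t. (\<integral>x. p (hopf_circle x t) \<partial>?\<mu>) \<partial>?I) = (\<integral>x. (\<integral>t. p (hopf_circle x t) \<partial>?I) \<partial>?\<mu>)"
    by (rule Fubini_integral[OF int, symmetric])
  also have "\<dots> = (\<integral>x. 0 \<partial>?\<mu>)"
    by (rule Bochner_Integration.integral_cong) (auto simp: inner S3_def)
  finally have "measure ?I (space ?I) * (\<integral>x. p x \<partial>?\<mu>) = 0"
    by (simp add: outer)
  moreover have "measure ?I (space ?I) = 2 * pi"
    by (simp add: measure_restrict_space space_restrict_space)
  ultimately show ?thesis by simp
qed

lemma continuous_on_VF: "V \<in> VF_S3 \<Longrightarrow> continuous_on S3 V"
  by (auto simp: VF_S3_def intro: smooth_on_imp_continuous_on)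

text \<open>Along a fibre the inner product becomes that of the rotated coefficient of
  \<open>V\<close>, which integrates to zero, with the constant vector
  \<open>horiz X x\<close>.\<close>

lemma BVF_orthogonal_PVF:
  assumes V: "V \<in> BVF" and X: "X \<in> PVF"
  shows "L2_inner V X = 0"
  unfolding L2_inner_def
proof (rule fiber_integrals_zero_imp)
  have VF: "V \<in> VF_S3" "X \<in> VF_S3" using V X by (auto simp: BVF_iff PVF_iff)
  then show "continuous_on S3 (\<lambda>x. V x \<bullet> X x)"
    by (intro continuous_on_inner continuous_on_VF)
  fix x assume x: "x \<in> S3"
  have "V (hopf_circle x t) \<bullet> X (hopf_circle x t) =
      (cis (- 2 * t) * horiz V (hopf_circle x t)) \<bullet> horiz X x" for t
  proof -
    let ?y = "hopf_circle x t"
    have y: "?y \<in> S3" using x by (rule hopf_circle_S3)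
    have "V ?y \<bullet> X ?y = frame_field (vert V) (horiz V) ?y \<bullet> frame_field (vert X) (horiz X) ?y"
      using VF frame_field_VF by metis
    also have "\<dots> = horiz V ?y \<bullet> horiz X ?y"
      using V y by (simp add: inner_frame_field BVF_iff)
    also have "\<dots> = horiz V ?y \<bullet> (cis (2 * t) * horiz X x)"
      using X x by (simp add: PVF_iff)
    \<comment> \<open>Multiplication by \<open>cis (2 * t)\<close> has adjoint multiplication by
      \<open>cis (- 2 * t)\<close>.\<close>
    also have "\<dots> = (cis (- 2 * t) * horiz V ?y) \<bullet> horiz X x"
      by (simp add: inner_complex_def algebra_simps)
    finally show ?thesis .
  qed
  moreover have "((\<lambda>t. (cis (- 2 * t) * horiz V (hopf_circle x t)) \<bullet> horiz X x) has_integral 0) {0..2*pi}"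
    using has_integral_linear[OF _ bounded_linear_inner_left, of _ 0 _ "horiz X x"] V x
    by (auto simp: BVF_iff o_def)
  ultimately show "((\<lambda>t. V (hopf_circle x t) \<bullet> X (hopf_circle x t)) has_integral 0) {0..2 * pi}"
    by simp
qed

text \<open>For the inclusion into \<open>BVF\<close>, pairing \<open>V\<close> with its own
  projectable part \<open>P\<close> leaves the integral of \<open>P x \<bullet> P x\<close>, as the
  balanced part is orthogonal to \<open>P\<close>. Continuity then forces
  \<open>P = 0\<close>.\<close>

lemma L2_complement_PVF: "L2_orthogonal_complement PVF = BVF"
proof (intro equalityI subsetI)
  fix V assume "V \<in> BVF"
  then show "V \<in> L2_orthogonal_complement PVF"
    using BVF_orthogonal_PVF by (auto simp: L2_orthogonal_complement_def BVF_iff)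
next
  fix V assume "V \<in> L2_orthogonal_complement PVF"
  then have V: "V \<in> VF_S3" and orth: "\<And>X. X \<in> PVF \<Longrightarrow> L2_inner V X = 0"
    by (auto simp: L2_orthogonal_complement_def)
  define P where "P = projectable_part V"
  define B where "B = balanced_part V"
  have P: "P \<in> PVF" and B: "B \<in> BVF" and PB: "P + B = V"
    using decomposition[OF V] by (auto simp: P_def B_def)
  have cont: "continuous_on (sphere 0 1) P" "continuous_on (sphere 0 1) B"
    using P B continuous_on_VF by (auto simp: PVF_iff BVF_iff S3_def)
  have "0 = (\<integral>x. V x \<bullet> P x \<partial>sphere_measure)"
    using orth[OF P] by (simp add: L2_inner_def)
  also have "\<dots> = (\<integral>x. P x \<bullet> P x + B x \<bullet> P x \<partial>sphere_measure)"
    by (simp add: PB[symmetric] inner_add_left)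
  also have "\<dots> = (\<integral>x. P x \<bullet> P x \<partial>sphere_measure) + (\<integral>x. B x \<bullet> P x \<partial>sphere_measure)"
    by (intro Bochner_Integration.integral_add integrable_sphere_measure(2) continuous_on_inner cont)
  also have "\<dots> = (\<integral>x. P x \<bullet> P x \<partial>sphere_measure)"
    using BVF_orthogonal_PVF[OF B P] by (simp add: L2_inner_def)
  finally have "(\<integral>x. P x \<bullet> P x \<partial>sphere_measure) = 0" by simp
  then have "P x = 0" if "x \<in> S3" for x
    using sphere_integral_zero_imp[of "\<lambda>x. P x \<bullet> P x" x] that cont(1)
    by (auto simp: S3_def intro: continuous_on_inner)
  moreover have "P x = 0" if "x \<notin> S3" for x
    using P that unfolding PVF_iff VF_S3_def by blast
  ultimately have "P = 0" by (auto simp: fun_eq_iff)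
  then show "V \<in> BVF" using B PB by simp
qed


section \<open>The tangent space of the automorphism group\<close>

text \<open>Joint smoothness supplies a local extension \<open>g\<close> near
  \<open>(0, x0)\<close>, and the velocity is its derivative in the time direction
  \<open>(1, 0)\<close>, a smooth function of \<open>x\<close> on the slice at time 0.\<close>

lemma smooth_curve_velocity:
  fixes \<phi> :: "real \<Rightarrow> 'a::euclidean_space \<Rightarrow> 'b::euclidean_space"
  assumes \<phi>: "smooth_on ({-\<epsilon><..<\<epsilon>} \<times> S) (\<lambda>(t, x). \<phi> t x)" and \<epsilon>: "\<epsilon> > 0"
    and X: "\<And>x. x \<in> S \<Longrightarrow> ((\<lambda>t. \<phi> t x) has_vector_derivative X x) (at 0)"
  shows "smooth_on S X"
proof (rule smooth_on_locally)
  fix x0 assume "x0 \<in> S"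
  then obtain U g where U: "open U" "(0, x0) \<in> U" "smooth_on U g"
      and g: "\<And>z. z \<in> U \<inter> ({-\<epsilon><..<\<epsilon>} \<times> S) \<Longrightarrow> g z = (\<lambda>(t, x). \<phi> t x) z"
    using smooth_onE[OF \<phi>, of "(0, x0)"] \<epsilon> by auto
  let ?V = "Pair (0::real) -` U"
  have V: "open ?V"
    by (intro open_vimage U continuous_intros)
  have "smooth_on (?V \<inter> S) X"
  proof (rule smooth_on_cong)
    show "smooth_on (?V \<inter> S) (\<lambda>x. frechet_derivative g (at (0, x)) (1, 0))"
      by (rule smooth_on_compose[OF smooth_on_derivative(2)[OF U(1,3)]])
        (auto intro: smooth_on_Pair smooth_on_const smooth_on_ident)
    fix x assume x: "x \<in> ?V \<inter> S"
    have "((\<lambda>t. (t, x)) has_derivative (\<lambda>s. (s, 0))) (at 0)"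
      by (auto intro!: derivative_eq_intros)
    from has_derivative_compose[OF this smooth_on_derivative(1)[OF U(1,3)]] x
    have "((\<lambda>t. g (t, x)) has_derivative (\<lambda>s. frechet_derivative g (at (0, x)) (s, 0))) (at 0)"
      by auto
    moreover have "(\<lambda>s. frechet_derivative g (at (0, x)) (s, 0)) =
        (\<lambda>s. s *\<^sub>R frechet_derivative g (at (0, x)) (1, 0))"
    proof
      fix s :: real
      have "linear (frechet_derivative g (at (0, x)))"
        using smooth_on_derivative(1)[OF U(1,3)] x has_derivative_linear by blast
      from linear_scale[OF this, of s "(1, 0)"]
      show "frechet_derivative g (at (0, x)) (s, 0) = s *\<^sub>R frechet_derivative g (at (0, x)) (1, 0)"
        by simp
    qed
    ultimately have "((\<lambda>t. g (t, x)) has_vector_derivative frechet_derivative g (at (0, x)) (1, 0)) (at 0)"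
      by (simp only: has_vector_derivative_def)
    moreover have "open ((\<lambda>t. (t, x)) -` U \<inter> {-\<epsilon><..<\<epsilon>})"
      by (intro open_Int open_vimage U continuous_intros open_greaterThanLessThan)
    moreover have "0 \<in> (\<lambda>t. (t, x)) -` U \<inter> {-\<epsilon><..<\<epsilon>}"
      using x \<epsilon> by auto
    ultimately have "((\<lambda>t. \<phi> t x) has_vector_derivative frechet_derivative g (at (0, x)) (1, 0)) (at 0)"
      by (rule has_vector_derivative_transform_within_open) (use g x in auto)
    then show "frechet_derivative g (at (0, x)) (1, 0) = X x"
      using X x vector_derivative_unique_at by blast
  qed
  then show "\<exists>U. open U \<and> x0 \<in> U \<and> smooth_on (U \<inter> S) X"
    using V U(2) by (intro exI[of _ ?V]) auto
qed

lemma Aut_H_respects_fibers: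
  assumes "\<phi> \<in> Aut_H" "x \<in> S3"
  shows "hopf (\<phi> (hopf_circle x s)) = hopf (\<phi> x)"
proof -
  have "hopf_fiber x \<in> hopf_fibers"
    using assms(2) by (simp add: hopf_fibers_def)
  then have "\<phi> ` hopf_fiber x \<in> hopf_fibers"
    using assms(1) bij_betwE unfolding Aut_H_def by fastforce
  then obtain y where y: "y \<in> S3" "\<phi> ` hopf_fiber x = hopf_fiber y"
    by (auto simp: hopf_fibers_def)
  have "x \<in> hopf_fiber x" "hopf_circle x s \<in> hopf_fiber x"
    using assms(2) hopf_circle_S3 hopf_hopf_circle by (auto simp: hopf_fiber_eq)
  then have "\<phi> x \<in> hopf_fiber y" "\<phi> (hopf_circle x s) \<in> hopf_fiber y"
    using y by blast+
  then show ?thesis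
    using y(1) by (simp add: hopf_fiber_eq)
qed

text \<open>Two identities are differentiated at time 0: curves stay on the sphere, which gives
  tangency, and \<open>hopf (\<phi> t (hopf_circle x s)) = hopf (\<phi> t x)\<close>, which gives
  equal push-forwards along each fibre.\<close>

lemma T_id_Aut_H_subset_PVF: "T_id_Aut_H \<subseteq> PVF"
proof
  fix X assume "X \<in> T_id_Aut_H"
  then obtain \<epsilon> \<phi> where off: "\<And>x. x \<notin> S3 \<Longrightarrow> X x = 0" and \<epsilon>: "\<epsilon> > 0"
    and Aut: "\<And>t. t \<in> {-\<epsilon><..<\<epsilon>} \<Longrightarrow> \<phi> t \<in> Aut_H"
    and sm: "smooth_on ({-\<epsilon><..<\<epsilon>} \<times> S3) (\<lambda>(t, x). \<phi> t x)"
    and \<phi>0: "\<And>x. x \<in> S3 \<Longrightarrow> \<phi> 0 x = x"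
    and der: "\<And>x. x \<in> S3 \<Longrightarrow> ((\<lambda>t. \<phi> t x) has_vector_derivative X x) (at 0)"
    unfolding T_id_Aut_H_def by blast
  have in_S3: "\<phi> t x \<in> S3" if "t \<in> {-\<epsilon><..<\<epsilon>}" "x \<in> S3" for t x
    using Aut[OF that(1)] that(2) bij_betwE unfolding Aut_H_def Diff_S3_def by blast
  have tangent: "X x \<bullet> x = 0" if x: "x \<in> S3" for x
  proof -
    have d: "((\<lambda>t. \<phi> t x) has_derivative (\<lambda>s. s *\<^sub>R X x)) (at 0)"
      using der[OF x] by (simp add: has_vector_derivative_def)
    have "((\<lambda>t. \<phi> t x \<bullet> \<phi> t x) has_derivative (\<lambda>s. \<phi> 0 x \<bullet> s *\<^sub>R X x + s *\<^sub>R X x \<bullet> \<phi> 0 x)) (at 0)"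
      by (intro has_derivative_inner d)
    moreover have "((\<lambda>t. \<phi> t x \<bullet> \<phi> t x) has_derivative (\<lambda>s. 0)) (at 0)"
    proof (rule has_derivative_transform_within_open[OF has_derivative_const])
      show "open {-\<epsilon><..<\<epsilon>}" "0 \<in> {-\<epsilon><..<\<epsilon>}" using \<epsilon> by auto
      show "1 = \<phi> t x \<bullet> \<phi> t x" if "t \<in> {-\<epsilon><..<\<epsilon>}" for t
        using in_S3[OF that x] by (simp add: norm_S3 dot_square_norm)
    qed
    ultimately have "(\<lambda>s::real. \<phi> 0 x \<bullet> s *\<^sub>R X x + s *\<^sub>R X x \<bullet> \<phi> 0 x) = (\<lambda>s. 0)"
      by (rule has_derivative_unique)
    from fun_cong[OF this, of 1] show ?thesis
      using \<phi>0[OF x] by (simp add: inner_commute)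
  qed
  have VF: "X \<in> VF_S3"
    unfolding VF_S3_def using smooth_curve_velocity[OF sm \<epsilon> der] tangent off by blast
  have push: "((\<lambda>t. hopf (\<phi> t x)) has_derivative (\<lambda>s. hopf_push x (s *\<^sub>R X x))) (at 0)" if x: "x \<in> S3" for x
  proof -
    have "(hopf has_derivative hopf_push (\<phi> 0 x)) (at (\<phi> 0 x))"
      unfolding hopf_push[abs_def] by (rule has_derivative_hopf)
    from has_derivative_compose[OF der[OF x, unfolded has_vector_derivative_def] this]
    show ?thesis using \<phi>0[OF x] by simp
  qed
  show "X \<in> PVF"
  proof (rule PVF_I[OF VF])
    fix x s assume x: "x \<in> S3"
    have "((\<lambda>t. hopf (\<phi> t x)) has_derivative
        (\<lambda>r. hopf_push (hopf_circle x s) (r *\<^sub>R X (hopf_circle x s)))) (at 0)"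
    proof (rule has_derivative_transform_within_open[OF push[OF hopf_circle_S3[OF x]]])
      show "open {-\<epsilon><..<\<epsilon>}" "0 \<in> {-\<epsilon><..<\<epsilon>}" using \<epsilon> by auto
      show "hopf (\<phi> t (hopf_circle x s)) = hopf (\<phi> t x)" if "t \<in> {-\<epsilon><..<\<epsilon>}" for t
        by (rule Aut_H_respects_fibers[OF Aut[OF that] x])
    qed
    from has_derivative_unique[OF this push[OF x]]
    show "hopf_push (hopf_circle x s) (X (hopf_circle x s)) = hopf_push x (X x)"
      by (metis scaleR_one)
  qed
qed

section \<open>Curves of automorphisms with prescribed velocity\<close>

text \<open>The factor with \<open>h\<close> is equivariant under the circle action when \<open>h\<close> turns at double speed, and
  the factor with \<open>f\<close> moves points along their fibres, so fibres are mapped to fibres without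
  recourse to flows.  The factor \<open>norm x\<close> extends the curve homogeneously off the sphere.\<close>

definition lift_curve :: "(quat \<Rightarrow> real) \<Rightarrow> (quat \<Rightarrow> complex) \<Rightarrow> real \<Rightarrow> quat \<Rightarrow> quat" where
  "lift_curve f h t x = norm x *\<^sub>R sgn (qmult (sgn x)
     (qmult (1, of_real t * h (sgn x)) (1 + \<i> * of_real (t * f (sgn x)), 0)))"

lemma sgn_qmult: "sgn (qmult x y) = qmult (sgn x) (sgn y)"
  by (simp add: sgn_div_norm norm_qmult qmult_simps)

lemma lift_curve_factor_nonzero:
  "(1::complex, z::complex) \<noteq> 0" "(1 + \<i> * of_real a, 0::complex) \<noteq> 0"
  by (auto simp: zero_prod_def complex_eq_iff)

lemma qmult_nonzero: "x \<noteq> 0 \<Longrightarrow> y \<noteq> 0 \<Longrightarrow> qmult x y \<noteq> 0"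
  by (metis mult_eq_0_iff norm_eq_zero norm_qmult)

lemma norm_lift_curve: "norm (lift_curve f h t x) = norm x"
proof (cases "x = 0")
  case False
  then have "qmult (sgn x) (qmult (1, of_real t * h (sgn x)) (1 + \<i> * of_real (t * f (sgn x)), 0)) \<noteq> 0"
    by (intro qmult_nonzero lift_curve_factor_nonzero) (simp add: sgn_zero_iff)
  then show ?thesis
    by (simp add: lift_curve_def norm_sgn)
qed (simp add: lift_curve_def)

lemma lift_curve_0 [simp]: "lift_curve f h 0 x = x"
  by (cases "x = 0") (simp_all add: lift_curve_def sgn_div_norm)

lemma lift_curve_scale:
  assumes "r > 0"
  shows "lift_curve f h t (r *\<^sub>R x) = r *\<^sub>R lift_curve f h t x"
proof -
  have "sgn (r *\<^sub>R x) = sgn x" using assms by (simp add: sgn_scaleR)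
  then show ?thesis using assms by (simp add: lift_curve_def)
qed

lemma smooth_on_lift_curve:
  assumes f: "smooth_on S3 f" and h: "smooth_on S3 h"
  shows "smooth_on (UNIV \<times> - {0}) (\<lambda>z. lift_curve f h (fst z) (snd z))"
proof -
  let ?M = "(UNIV :: real set) \<times> (- {0 :: quat})"
  have sgn: "smooth_on ?M (\<lambda>z. sgn (snd z))"
    by (intro smooth_on_sgn smooth_on_snd smooth_on_ident) auto
  have sub: "(\<lambda>z. sgn (snd z)) ` ?M \<subseteq> S3"
    by (rule image_subsetI, rule sgn_S3) auto
  note fs = smooth_on_compose[OF f sgn sub] and hs = smooth_on_compose[OF h sgn sub]
  show ?thesis
    unfolding lift_curve_def
    by (intro smooth_on_scaleR smooth_on_norm smooth_on_snd smooth_on_ident smooth_on_sgn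
        smooth_on_qmult sgn smooth_on_Pair smooth_on_const smooth_on_mult smooth_on_add smooth_on_of_real
        smooth_on_fst fs hs qmult_nonzero lift_curve_factor_nonzero)
      (auto simp: sgn_zero_iff)
qed

text \<open>Passing \<open>cis s\<close> to the right through the factor with \<open>h\<close>
  absorbs the weight of \<open>h\<close>, so the image of a whole circle has one base point. The
  other factor has argument \<open>arctan (t * f (hopf_circle x s))\<close> and only changes the
  phase.\<close>

lemma lift_curve_hopf_circle:
  assumes x: "x \<in> S3" and h: "h (hopf_circle x s) = cis (2 * s) * h x"
  shows "lift_curve f h t (hopf_circle x s) =
    hopf_circle (sgn (qmult x (1, of_real t * h x))) (s + arctan (t * f (hopf_circle x s)))"
proof -
  let ?y = "hopf_circle x s" and ?a = "t * f (hopf_circle x s)"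
  have y: "sgn ?y = ?y" "norm ?y = 1"
    using hopf_circle_S3[OF x] by (auto simp: sgn_S3_ident norm_S3)
  have "qmult (cis s, 0) (1, of_real t * h ?y) = qmult (1, of_real t * h x) (cis s, 0)"
  proof -
    have "cnj (cis s) * cis (2 * s) = cis s"
      by (simp add: cis_cnj cis_mult)
    then have "cnj (cis s) * (of_real t * (cis (2 * s) * h x)) = of_real t * h x * cis s"
      by (metis mult.assoc mult.commute)
    then show ?thesis by (simp add: h qmult_def)
  qed
  then have "qmult ?y (qmult (1, of_real t * h ?y) (1 + \<i> * of_real ?a, 0)) =
      qmult (qmult x (1, of_real t * h x)) (qmult (cis s, 0) (1 + \<i> * of_real ?a, 0))"
    by (metis hopf_circle_def qmult_assoc)
  moreover have "sgn (1 + \<i> * of_real ?a, 0::complex) = (cis (arctan ?a), 0)"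
  proof -
    have "norm (1 + \<i> * of_real ?a, 0::complex) = sqrt (1 + ?a\<^sup>2)"
      by (simp add: norm_Pair cmod_def)
    then show ?thesis
      by (simp add: sgn_div_norm complex_eq_iff cos_arctan sin_arctan divide_inverse mult.commute)
  qed
  moreover have "qmult (cis s, 0) (cis (arctan ?a), 0) = (cis (s + arctan ?a), 0)"
    by (simp add: qmult_def cis_mult)
  ultimately show ?thesis
    unfolding lift_curve_def y
    by (simp add: sgn_qmult sgn_S3_ident[OF cis_S3] hopf_circle_def)
qed

lemma hopf_fiber_UNIV: "x \<in> S3 \<Longrightarrow> hopf_fiber x = range (hopf_circle x)"
  by (auto simp: hopf_fiber_eq hopf_eq_iff hopf_circle_S3)

lemma lift_curve_fiber:
  assumes f: "smooth_on S3 f" and h: "\<And>x s. x \<in> S3 \<Longrightarrow> h (hopf_circle x s) = cis (2 * s) * h x"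
    and x: "x \<in> S3"
  shows "lift_curve f h t ` hopf_fiber x \<in> hopf_fibers"
proof -
  let ?B = "sgn (qmult x (1, of_real t * h x))"
  let ?\<theta> = "\<lambda>s. s + arctan (t * f (hopf_circle x s))"
  have B: "?B \<in> S3"
    using x by (intro sgn_S3 qmult_nonzero lift_curve_factor_nonzero S3_not_0)
  have "continuous_on UNIV (\<lambda>s. f (hopf_circle x s))"
    by (rule smooth_on_imp_continuous_on, rule smooth_on_compose[OF f])
      (auto simp: hopf_circle_S3 x intro: smooth_on_hopf_circle smooth_on_const smooth_on_ident)
  then have cont: "continuous_on {a..b} ?\<theta>" for a b
    by (intro continuous_intros) (auto intro: continuous_on_subset)
  \<comment> \<open>\<open>arctan\<close> is bounded by \<open>pi/2\<close>, so the phase is at most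
    \<alpha> at \<open>\<alpha> - pi/2\<close> and at least \<alpha> at
    \<open>\<alpha> + pi/2\<close>; the intermediate value theorem applies.\<close>
  have surj: "\<exists>s. ?\<theta> s = \<alpha>" for \<alpha>
  proof -
    have "?\<theta> (\<alpha> - pi/2) \<le> \<alpha>" "\<alpha> \<le> ?\<theta> (\<alpha> + pi/2)"
      using arctan_ubound arctan_lbound by (smt (verit))+
    then show ?thesis
      using IVT'[of ?\<theta> "\<alpha> - pi/2" \<alpha> "\<alpha> + pi/2"] cont pi_gt_zero by auto
  qed
  have "lift_curve f h t ` hopf_fiber x = range (\<lambda>s. hopf_circle ?B (?\<theta> s))"
    using lift_curve_hopf_circle[OF x h[OF x]] by (simp add: hopf_fiber_UNIV[OF x] image_image)
  also have "\<dots> = range (hopf_circle ?B)"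
  proof (intro equalityI image_subsetI)
    fix \<alpha>
    obtain s where "?\<theta> s = \<alpha>" using surj by blast
    then show "hopf_circle ?B \<alpha> \<in> range (\<lambda>s. hopf_circle ?B (?\<theta> s))" by blast
  qed blast
  also have "\<dots> = hopf_fiber ?B" by (rule hopf_fiber_UNIV[OF B, symmetric])
  finally show ?thesis using B by (simp add: hopf_fibers_def)
qed

text \<open>The unnormalised curve \<open>m\<close> has velocity \<open>V x\<close>, orthogonal to
  \<open>m 0 = x\<close>. Its norm is thus stationary at time 0, and normalising does not change the
  velocity.\<close>

lemma lift_curve_velocity:
  assumes V: "V \<in> VF_S3" and x: "x \<in> S3"
  shows "((\<lambda>t. lift_curve (vert V) (horiz V) t x) has_vector_derivative V x) (at 0)"
proof -
  let ?f = "vert V x" and ?h = "horiz V x"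
  define m where "m t = qmult x (qmult (1, of_real t * ?h) (1 + \<i> * of_real (t * ?f), 0))" for t
  have Vx: "V x = qmult x (\<i> * of_real ?f, ?h)"
    using V x by (intro frame_decomposition) (auto simp: VF_S3_def)
  have p: "((\<lambda>t. (1, of_real t * ?h)) has_derivative (\<lambda>s. (0, of_real s * ?h))) (at 0)"
    by (auto intro!: derivative_eq_intros)
  have q: "((\<lambda>t. (1 + \<i> * of_real (t * ?f), 0::complex)) has_derivative (\<lambda>s. (\<i> * of_real (s * ?f), 0))) (at 0)"
    by (auto intro!: derivative_eq_intros)
  have "((\<lambda>t. qmult (1, of_real t * ?h) (1 + \<i> * of_real (t * ?f), 0)) has_derivative
      (\<lambda>s. s *\<^sub>R (\<i> * of_real ?f, ?h))) (at 0)"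
    by (rule has_derivative_eq_rhs[OF bounded_bilinear.FDERIV[OF bounded_bilinear_qmult p q]])
      (auto simp: qmult_def fun_eq_iff scaleR_conv_of_real)
  from bounded_linear.has_derivative[OF bounded_bilinear.bounded_linear_right[OF bounded_bilinear_qmult] this]
  have m': "(m has_derivative (\<lambda>s. s *\<^sub>R V x)) (at 0)"
    by (simp only: m_def[abs_def] qmult_simps Vx)
  have m0: "m 0 = x" by (simp add: m_def)
  have "((\<lambda>t. norm (m t)) has_derivative (\<lambda>s. s *\<^sub>R V x \<bullet> sgn (m 0))) (at 0)"
    using m0 S3_not_0[OF x] by (intro has_derivative_compose[OF m' has_derivative_norm]) auto
  then have n': "((\<lambda>t. norm (m t)) has_derivative (\<lambda>s. 0)) (at 0)"
    using V x by (simp add: m0 sgn_S3_ident VF_S3_def)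
  have "((\<lambda>t. inverse (norm (m t))) has_derivative
      (\<lambda>s. - (inverse (norm (m 0)) * 0 * inverse (norm (m 0))))) (at 0)"
    by (rule Deriv.has_derivative_inverse[OF _ n']) (use m0 S3_not_0[OF x] in simp)
  from has_derivative_scaleR[OF this m']
  have "((\<lambda>t. sgn (m t)) has_derivative (\<lambda>s. s *\<^sub>R V x)) (at 0)"
    using x by (simp add: m0 sgn_div_norm norm_S3)
  moreover have "lift_curve (vert V) (horiz V) t x = sgn (m t)" for t
    using x by (simp add: lift_curve_def m_def sgn_S3_ident norm_S3)
  ultimately show ?thesis by (simp add: has_vector_derivative_def)
qed

text \<open>At time 0 the map is the identity, so compactness of \<open>S3\<close> makes its
  derivative uniformly close to the identity for small \<open>t\<close>. By homogeneity the
  derivative is constant along rays, which carries the bound to every nonzero \<open>x\<close>. The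
  constant \<open>1 / 2\<close> is a convenient contraction factor below 1.\<close>

lemma lift_curve_near_identity:
  assumes f: "smooth_on S3 f" and h: "smooth_on S3 h"
  obtains \<epsilon> where "\<epsilon> > 0"
    "\<And>t x v. \<bar>t\<bar> < \<epsilon> \<Longrightarrow> x \<noteq> 0 \<Longrightarrow> 
      \<exists>D. (lift_curve f h t has_derivative D) (at x) \<and> (\<forall>v. norm (D v - v) \<le> 1 / 2 * norm v)"
proof -
  let ?F = "\<lambda>z. lift_curve f h (fst z) (snd z)" and ?M = "(UNIV :: real set) \<times> (- {0 :: quat})"
  have M: "open ?M" by (intro open_Times open_Compl) auto
  note sm = smooth_on_lift_curve[OF f h]
  define D where "D t x v = frechet_derivative ?F (at (t, x)) (0, v)" for t x v
  have der: "(lift_curve f h t has_derivative D t x) (at x)" if "x \<noteq> 0" for t x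
  proof -
    have "(Pair t has_derivative (\<lambda>v. (0, v))) (at x)"
      by (auto intro!: derivative_eq_intros)
    from has_derivative_compose[OF this smooth_on_derivative(1)[OF M sm]] that
    show ?thesis by (simp add: D_def[abs_def])
  qed
  have lin: "linear (D t x)" if "x \<noteq> 0" for t x
    using der[OF that] has_derivative_linear by blast
  have D0: "D 0 x v = v" if "x \<noteq> 0" for x v
  proof -
    have "(lift_curve f h 0 has_derivative (\<lambda>v. v)) (at x)"
      using has_derivative_ident[of "at x"] by (simp only: lift_curve_0[abs_def])
    from has_derivative_unique[OF der[OF that] this] show ?thesis by metis
  qed
  \<comment> \<open>A continuous bound for the operator norm of the deviation from the identity,
    zero at time 0.\<close>
  define e where "e z = (\<Sum>b\<in>Basis. norm (D (fst z) (snd z) b - b))" for z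
  have "continuous_on ?M e"
    unfolding e_def D_def prod.collapse
    by (intro continuous_on_sum continuous_on_norm continuous_on_diff continuous_on_const
        smooth_on_imp_continuous_on[OF smooth_on_derivative(2)[OF M sm]])
  then have "continuous_on ({-1..1} \<times> S3) e"
    by (rule continuous_on_subset) (auto dest: S3_not_0)
  then have "uniformly_continuous_on ({-1..1} \<times> S3) e"
    by (rule compact_uniformly_continuous) (auto simp: S3_def intro: compact_Times)
  then obtain d where d: "d > 0" "\<And>z z'. z \<in> {-1..1} \<times> S3 \<Longrightarrow> z' \<in> {-1..1} \<times> S3 \<Longrightarrow>
      dist z' z < d \<Longrightarrow> dist (e z') (e z) < 1/2"
    unfolding uniformly_continuous_on_def by (metis half_gt_zero zero_less_one)
  have bound: "norm (D t x v - v) \<le> 1 / 2 * norm v" if t: "\<bar>t\<bar> < min d 1" and x: "x \<in> S3" for t x v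
  proof -
    have "e (0, x) = 0"
      using D0 S3_not_0[OF x] by (simp add: e_def)
    moreover have "dist (e (t, x)) (e (0, x)) < 1/2"
      using t x by (intro d(2)) (auto simp: dist_Pair_Pair)
    ultimately have e: "e (t, x) \<le> 1/2" by (simp add: dist_real_def)
    have "D t x v - v = (\<Sum>b\<in>Basis. (v \<bullet> b) *\<^sub>R (D t x b - b))"
      by (rule linear_basis_expansion[of "\<lambda>v. D t x v - v"])
        (intro linear_compose_sub lin S3_not_0 x linear_ident)
    also have "norm \<dots> \<le> (\<Sum>b\<in>Basis. norm v * norm (D t x b - b))"
      by (rule sum_norm_le) (auto intro!: mult_right_mono Basis_le_norm)
    also have "\<dots> = e (t, x) * norm v"
      by (simp add: e_def sum_distrib_left mult.commute)
    also have "\<dots> \<le> 1 / 2 * norm v"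
      by (rule mult_right_mono[OF e]) simp
    finally show ?thesis .
  qed
  show thesis
  \<comment> \<open>The minimum with 1 keeps \<open>t\<close> inside the compact interval on which
    \<open>e\<close> is uniformly continuous.\<close>
  proof (rule that[of "min d 1"])
    fix t x v assume t: "\<bar>t\<bar> < min d 1" and x: "x \<noteq> (0 :: quat)"
    let ?r = "norm x" and ?u = "sgn x"
    have u: "?u \<in> S3" using x by (rule sgn_S3)
    have r: "?r > 0" using x by simp
    have "((\<lambda>y. y /\<^sub>R ?r) has_derivative (\<lambda>v. v /\<^sub>R ?r)) (at x)"
      by (auto intro!: derivative_eq_intros)
    moreover have "(lift_curve f h t has_derivative D t ?u) (at (x /\<^sub>R ?r))"
      using der[OF S3_not_0[OF u], of t] by (simp add: sgn_div_norm)
    ultimately have "((\<lambda>y. lift_curve f h t (y /\<^sub>R ?r)) has_derivative (\<lambda>v. D t ?u (v /\<^sub>R ?r))) (at x)"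
      by (rule has_derivative_compose)
    then have "((\<lambda>y. ?r *\<^sub>R lift_curve f h t (y /\<^sub>R ?r)) has_derivative (\<lambda>v. ?r *\<^sub>R D t ?u (v /\<^sub>R ?r))) (at x)"
      by (rule has_derivative_scaleR_right)
    moreover have "?r *\<^sub>R lift_curve f h t (y /\<^sub>R ?r) = lift_curve f h t y" for y
      using r lift_curve_scale[of ?r f h t "y /\<^sub>R ?r"] by simp
    moreover have "linear (D t ?u)" by (intro lin S3_not_0 u)
    then have "?r *\<^sub>R D t ?u (v /\<^sub>R ?r) = D t ?u v" for v
      using r linear_scale[of "D t ?u" "inverse ?r" v] by simp
    ultimately have "(lift_curve f h t has_derivative D t ?u) (at x)" by simp
    then show "\<exists>D. (lift_curve f h t has_derivative D) (at x) \<and> (\<forall>v. norm (D v - v) \<le> 1 / 2 * norm v)"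
      using bound[OF t u] by blast
  qed (use d in auto)
qed

text \<open>The mean value inequality works on segments that avoid 0. If the segment meets 0, then
  \<open>norm (x - y) = norm x + norm y\<close>, and the triangle inequality reduces the claim to a
  bound on \<open>norm (G z)\<close>.\<close>

lemma homogeneous_lipschitz:
  fixes G :: "'a::euclidean_space \<Rightarrow> 'b::real_normed_vector"
  assumes G: "\<And>x. x \<noteq> 0 \<Longrightarrow> \<exists>D. (G has_derivative D) (at x) \<and> (\<forall>v. norm (D v) \<le> c * norm v)"
    and hom: "\<And>r x. r > 0 \<Longrightarrow> G (r *\<^sub>R x) = r *\<^sub>R G x" and G0: "G 0 = 0" and c: "0 \<le> c"
  shows "norm (G x - G y) \<le> c * norm (x - y)"
proof -
  have away: "norm (G x - G y) \<le> c * norm (x - y)" if "0 \<notin> closed_segment x y" for x y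
  proof -
    obtain D where D: "\<And>z. z \<noteq> 0 \<Longrightarrow> (G has_derivative D z) (at z)"
      "\<And>z v. z \<noteq> 0 \<Longrightarrow> norm (D z v) \<le> c * norm v"
      using G by metis
    show ?thesis
    proof (rule differentiable_bound[of "closed_segment x y" G D])
      fix z assume "z \<in> closed_segment x y"
      then have z: "z \<noteq> 0" using that by auto
      show "(G has_derivative D z) (at z within closed_segment x y)"
        using D(1)[OF z] has_derivative_at_withinI by blast
      show "onorm (D z) \<le> c"
        by (rule onorm_bound) (use D(2)[OF z] in \<open>auto simp: c\<close>)
    qed auto
  qed
  \<comment> \<open>The segment from a nonzero \<open>z\<close> to its half avoids 0, and by
    homogeneity \<open>G\<close> changes along it by exactly half of \<open>G z\<close>.\<close>
  have point: "norm (G z) \<le> c * norm z" for z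
  proof (cases "z = 0")
    case False
    have "0 \<notin> closed_segment z ((1/2) *\<^sub>R z)"
    proof
      assume "0 \<in> closed_segment z ((1/2) *\<^sub>R z)"
      then obtain u where "0 \<le> u" "u \<le> 1" "0 = (1 - u) *\<^sub>R z + u *\<^sub>R (1/2) *\<^sub>R z"
        by (auto simp: closed_segment_def)
      moreover have "(1 - u / 2) *\<^sub>R z = (1 - u) *\<^sub>R z + u *\<^sub>R (1/2) *\<^sub>R z"
        by (simp flip: scaleR_add_left)
      ultimately have "(1 - u / 2) *\<^sub>R z = 0" by metis
      then show False using False \<open>u \<le> 1\<close> by simp
    qed
    moreover have "G z - G ((1/2) *\<^sub>R z) = (1/2) *\<^sub>R G z"
      using scaleR_left_diff_distrib[of 1 "1/2" "G z"] by (simp add: hom)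
    moreover have "z - (1/2) *\<^sub>R z = (1/2) *\<^sub>R z"
      using scaleR_left_diff_distrib[of 1 "1/2" z] by simp
    ultimately show ?thesis using away[of z "(1/2) *\<^sub>R z"] by simp
  qed (simp add: G0)
  show ?thesis
  proof (cases "0 \<in> closed_segment x y")
    case True
    then have "norm (x - y) = norm x + norm y"
      using between[of x y 0] by (simp add: between_mem_segment dist_norm)
    then show ?thesis
      using norm_triangle_ineq4[of "G x" "G y"] point[of x] point[of y] by (simp add: distrib_left)
  qed (rule away)
qed

text \<open>Bijectivity is obtained for the homogeneous map on R^4 and smoothness of its inverse off
  the origin; both are then restricted, since a norm-preserving bijection and its inverse map
  \<open>S3\<close> to itself.\<close>

lemma lift_curve_in_Aut_H:
  assumes f: "smooth_on S3 f" and h: "smooth_on S3 h"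
    and weight: "\<And>x s. x \<in> S3 \<Longrightarrow> h (hopf_circle x s) = cis (2 * s) * h x"
    and near: "\<And>x. x \<noteq> 0 \<Longrightarrow>
      \<exists>D. (lift_curve f h t has_derivative D) (at x) \<and> (\<forall>v. norm (D v - v) \<le> 1 / 2 * norm v)"
  shows "restrict (lift_curve f h t) S3 \<in> Aut_H"
proof -
  let ?\<Phi> = "lift_curve f h t"
  define G where "G x = ?\<Phi> x - x" for x
  have \<Phi>: "?\<Phi> = (\<lambda>x. x + G x)" by (simp add: G_def fun_eq_iff)
  have DG: "\<exists>D. (G has_derivative D) (at x) \<and> (\<forall>v. norm (D v) \<le> 1 / 2 * norm v)" if x: "x \<noteq> 0" for x
  proof -
    obtain D where D: "(?\<Phi> has_derivative D) (at x)" "\<And>v. norm (D v - v) \<le> 1 / 2 * norm v"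
      using near[OF x] by blast
    have "(G has_derivative (\<lambda>v. D v - v)) (at x)"
      unfolding G_def[abs_def] by (intro has_derivative_diff D has_derivative_ident)
    then show ?thesis using D(2) by blast
  qed
  have Lip: "norm (G x - G y) \<le> 1 / 2 * norm (x - y)" for x y
  proof (rule homogeneous_lipschitz[OF DG])
    show "G (r *\<^sub>R x) = r *\<^sub>R G x" if "r > 0" for r x
      by (simp only: G_def lift_curve_scale[OF that] scaleR_diff_right)
    show "G 0 = 0" by (simp add: G_def lift_curve_def)
  qed auto
  have bij: "bij ?\<Phi>"
    unfolding \<Phi> by (rule bij_perturbation_of_identity[OF _ _ Lip]) auto
  have open0: "open (- {0 :: quat})" by (simp add: open_Compl)
  have "smooth_on (- {0}) (\<lambda>x. lift_curve f h (fst (t, x)) (snd (t, x)))"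
    by (rule smooth_on_compose[OF smooth_on_lift_curve[OF f h]])
      (auto intro: smooth_on_Pair smooth_on_const smooth_on_ident)
  then have sm: "smooth_on (- {0}) ?\<Phi>" by simp
  have "smooth_on (- {0}) G"
    unfolding G_def[abs_def] by (intro smooth_on_diff sm smooth_on_ident)
  moreover have "norm (frechet_derivative G (at x) v) \<le> 1 / 2 * norm v" if x: "x \<in> - {0}" for x v
  proof -
    obtain D where "(G has_derivative D) (at x)" "\<And>v. norm (D v) \<le> 1 / 2 * norm v"
      using DG[of x] x by auto
    then show ?thesis using frechet_derivative_at by metis
  qed
  ultimately have sm_inv: "smooth_on (?\<Phi> ` (- {0})) (inv ?\<Phi>)"
    unfolding \<Phi> by (intro smooth_inverse_perturbation_of_identity(2)[OF _ _ Lip open0]) auto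
  have inv_S3: "inv ?\<Phi> y \<in> S3" "?\<Phi> (inv ?\<Phi> y) = y" if "y \<in> S3" for y
  proof -
    show eq: "?\<Phi> (inv ?\<Phi> y) = y" using bij by (simp add: bij_is_surj surj_f_inv_f)
    then show "inv ?\<Phi> y \<in> S3"
      using that norm_lift_curve[of f h t "inv ?\<Phi> y"] by (simp add: norm_S3)
  qed
  let ?\<phi> = "restrict ?\<Phi> S3"
  have inj: "inj_on ?\<phi> S3"
    using bij by (auto simp: inj_on_def bij_def)
  have "?\<phi> ` S3 = S3"
  proof (intro equalityI subsetI)
    fix y assume y: "y \<in> S3"
    show "y \<in> ?\<phi> ` S3"
      using inv_S3[OF y] by (intro image_eqI[of _ _ "inv ?\<Phi> y"]) auto
  qed (auto simp: norm_S3 norm_lift_curve)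
  then have bijS: "bij_betw ?\<phi> S3 S3" using inj by (simp add: bij_betw_def)
  have "smooth_on S3 ?\<phi>"
    by (rule smooth_on_cong[OF smooth_on_subset[OF sm]]) (auto dest: S3_not_0)
  moreover have "smooth_on S3 (inv_into S3 ?\<phi>)"
  proof (rule smooth_on_cong[OF smooth_on_subset[OF sm_inv]])
    show "S3 \<subseteq> ?\<Phi> ` (- {0})"
    proof
      fix y assume "y \<in> S3"
      then show "y \<in> ?\<Phi> ` (- {0})"
        using inv_S3[of y] S3_not_0 by (intro image_eqI[of _ _ "inv ?\<Phi> y"]) auto
    qed
    fix y assume y: "y \<in> S3"
    show "inv ?\<Phi> y = inv_into S3 ?\<phi> y"
      by (rule inv_into_f_eq[OF inj, symmetric]) (use inv_S3[OF y] in auto)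
  qed
  ultimately have Diff: "?\<phi> \<in> Diff_S3"
    using bijS by (simp add: Diff_S3_def)
  have fiber_sub: "F \<subseteq> S3" if "F \<in> hopf_fibers" for F
    using that by (auto simp: hopf_fibers_def hopf_fiber_eq)
  have image: "?\<phi> ` F = ?\<Phi> ` F" if "F \<in> hopf_fibers" for F
    using fiber_sub[OF that] by (auto simp: image_def)
  have maps: "?\<phi> ` F \<in> hopf_fibers" if "F \<in> hopf_fibers" for F
  proof -
    obtain x where "x \<in> S3" "F = hopf_fiber x" using \<open>F \<in> hopf_fibers\<close> by (auto simp: hopf_fibers_def)
    then show ?thesis using lift_curve_fiber[OF f weight] image[OF that] by simp
  qed
  have "bij_betw (\<lambda>F. ?\<phi> ` F) hopf_fibers hopf_fibers"
    unfolding bij_betw_def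
  proof (intro conjI equalityI subsetI)
    show "inj_on (\<lambda>F. ?\<phi> ` F) hopf_fibers"
      using inj_on_image_eq_iff[OF inj] fiber_sub by (auto intro!: inj_onI)
    show "F \<in> hopf_fibers" if "F \<in> (\<lambda>F. ?\<phi> ` F) ` hopf_fibers" for F
      using that maps by blast
    \<comment> \<open>The fibre through the preimage of \<open>y\<close> is sent to some fibre; that
      fibre contains \<open>y\<close> and hence is \<open>F\<close>.\<close>
    fix F assume "F \<in> hopf_fibers"
    then obtain y where y: "y \<in> S3" "F = hopf_fiber y" by (auto simp: hopf_fibers_def)
    define x where "x = inv ?\<Phi> y"
    have x: "x \<in> S3" "?\<phi> x = y" using inv_S3[OF y(1)] by (auto simp: x_def)
    have "hopf_fiber x \<in> hopf_fibers" using x by (simp add: hopf_fibers_def)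
    with maps obtain z where z: "z \<in> S3" "?\<phi> ` hopf_fiber x = hopf_fiber z"
      by (force simp: hopf_fibers_def)
    have "x \<in> hopf_fiber x" using x by (simp add: hopf_fiber_eq)
    then have "y \<in> hopf_fiber z" using z x(2) by blast
    then have "hopf_fiber z = F"
      using z(1) y by (simp add: hopf_fiber_eq)
    then show "F \<in> (\<lambda>F. ?\<phi> ` F) ` hopf_fibers"
      using z(2) \<open>hopf_fiber x \<in> hopf_fibers\<close> by blast
  qed
  then show ?thesis using Diff unfolding Aut_H_def by blast
qed

lemma PVF_subset_T_id_Aut_H: "PVF \<subseteq> T_id_Aut_H"
proof
  fix V assume "V \<in> PVF"
  then have V: "V \<in> VF_S3"
    and weight: "\<And>x s. x \<in> S3 \<Longrightarrow> horiz V (hopf_circle x s) = cis (2 * s) * horiz V x"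
    by (auto simp: PVF_iff)
  note f = smooth_on_vert[OF V] and h = smooth_on_horiz[OF V]
  let ?L = "lift_curve (vert V) (horiz V)"
  obtain \<epsilon> where \<epsilon>: "\<epsilon> > 0" and near: "\<And>t x v. \<bar>t\<bar> < \<epsilon> \<Longrightarrow> x \<noteq> 0 \<Longrightarrow>
      \<exists>D. (?L t has_derivative D) (at x) \<and> (\<forall>v. norm (D v - v) \<le> 1 / 2 * norm v)"
    using lift_curve_near_identity[OF f h] by blast
  \<comment> \<open>Elements of \<open>Diff_S3\<close> are extensional on \<open>S3\<close>, hence
    the restriction.\<close>
  define \<phi> where "\<phi> t = restrict (?L t) S3" for t
  have "\<phi> t \<in> Aut_H" if "t \<in> {-\<epsilon><..<\<epsilon>}" for t
    unfolding \<phi>_def using that by (intro lift_curve_in_Aut_H f h weight near) auto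
  moreover have "smooth_on ({-\<epsilon><..<\<epsilon>} \<times> S3) (\<lambda>(t, x). \<phi> t x)"
  proof (rule smooth_on_cong[OF smooth_on_subset[OF smooth_on_lift_curve[OF f h]]])
    show "{-\<epsilon><..<\<epsilon>} \<times> S3 \<subseteq> UNIV \<times> - {0}" by (auto dest: S3_not_0)
  qed (auto simp: \<phi>_def)
  moreover have "\<phi> 0 x = x" if "x \<in> S3" for x using that by (simp add: \<phi>_def)
  moreover have "((\<lambda>t. \<phi> t x) has_vector_derivative V x) (at 0)" if "x \<in> S3" for x
    using lift_curve_velocity[OF V that] that by (simp add: \<phi>_def)
  moreover have "V x = 0" if "x \<notin> S3" for x
    using V that unfolding VF_S3_def by blast
  ultimately show "V \<in> T_id_Aut_H"
    unfolding T_id_Aut_H_def using \<epsilon> by blast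
qed

theorem theorem2p2:
  "T_id_Aut_H = PVF \<and>
   L2_orthogonal_complement T_id_Aut_H = BVF \<and>
   is_direct_sum PVF BVF VF_S3"
proof -
  have "T_id_Aut_H = PVF"
    using T_id_Aut_H_subset_PVF PVF_subset_T_id_Aut_H by blast
  then show ?thesis
    using L2_complement_PVF direct_sum_PVF_BVF by simp
qed

end
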